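(* Let $T:\mathbb{R}^2\to\mathbb{R}^2$ be an invertible linear transformation with inverse $$T^{-1}=\begin{pmatrix} a & b\\ c & d\end{pmatrix},\qquad ab\neq 0.$$ Let $\mu,\nu\in\mathcal{S}'(\mathbb{R})\setminus\{0\}$ satisfy $$W_T(\mu,\nu)=\sum_{(r,s)\in A\times B}c_{r,s}\,\delta_{(r,s)},$$ where $A,B\subset\mathbb{R}$ are uniformly discrete sets and $c_{r,s}\in\mathbb{C}$. Then $\mu$ and $\nu$ are measures supported in uniformly discrete sets.
   Context: A set $A\subset\mathbb{R}$ is uniformly discrete if there is $\delta>0$ such that $|r-s|\ge\delta$ for all $r,s\in A$ with $r\ne s$. $\delta_\xi$ denotes the point mass at $\xi$; the series is understood as an identity of tempered distributions on $\mathbb{R}^2$. A tempered distribution is called a measure if it is given by a locally finite complex Borel measure. For an invertible linear map $T:\mathbb{R}^2\to\mathbb{R}^2$ the same letter denotes the change of coordinate operator $TF=F\circ T$, extended to $\mathcal{S}'(\mathbb{R}^2)$ in the natural way (pull-back). $\mathcal{F}_2$ is the partial Fourier transform $\mathcal{F}_2F(x,\omega)=\int_{\mathbb{R}}F(x,t)e^{-2\pi i\omega t}\,dt$, extended to $\mathcal{S}'(\mathbb{R}^2)$. The matrix-Wigner transform of $\mu,\nu\in\mathcal{S}'(\mathbb{R})$ is $W_T(\mu,\nu)=\mathcal{F}_2\left(T(\mu\otimes\overline{\nu})\right)\in\mathcal{S}'(\mathbb{R}^2)$, where $\overline{\nu}$ is the complex conjugate distribution of $\nu$. *)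

theory Defs
  imports "HOL-Analysis.Analysis"
begin

section \<open>Schwartz functions and test functions\<close>

definition iterated_partial ::
    "'a::euclidean_space list \<Rightarrow> ('a \<Rightarrow> complex) \<Rightarrow> 'a \<Rightarrow> complex" where
  "iterated_partial vs f = foldr (\<lambda>v g x. frechet_derivative g (at x) v) vs f"

text \<open>All iterated partial derivatives exist and are totally differentiable everywhere; in
  particular each of them is continuous, so this is the usual notion of an infinitely
  differentiable function.\<close>

definition smooth :: "('a::euclidean_space \<Rightarrow> complex) \<Rightarrow> bool" where
  "smooth f \<longleftrightarrow>
     (\<forall>vs x. set vs \<subseteq> Basis \<longrightarrow> iterated_partial vs f differentiable (at x))"

definition schwartz :: "('a::euclidean_space \<Rightarrow> complex) \<Rightarrow> bool" where
  "schwartz f \<longleftrightarrow> smooth f \<and>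
     (\<forall>vs N. set vs \<subseteq> Basis \<longrightarrow>
        bounded (range (\<lambda>x. (1 + norm x) ^ N *\<^sub>R iterated_partial vs f x)))"

definition schwartz_seminorm :: "nat \<Rightarrow> ('a::euclidean_space \<Rightarrow> complex) \<Rightarrow> real" where
  "schwartz_seminorm N f =
     (\<Sum>vs | set vs \<subseteq> Basis \<and> length vs \<le> N.
        SUP x. (1 + norm x) ^ N * norm (iterated_partial vs f x))"

definition test_function :: "('a::euclidean_space \<Rightarrow> complex) \<Rightarrow> bool" where
  "test_function f \<longleftrightarrow> smooth f \<and> compact (closure {x. f x \<noteq> 0})"


section \<open>Tempered distributions\<close>

text \<open>A distribution is represented by a functional on all functions; only its values on
  Schwartz functions are meaningful.  Two functionals represent the same tempered distribution
  iff they agree on every Schwartz function.\<close>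

type_synonym 'a functional = "('a \<Rightarrow> complex) \<Rightarrow> complex"

definition tempered_distribution :: "'a::euclidean_space functional \<Rightarrow> bool" where
  "tempered_distribution u \<longleftrightarrow>
     (\<forall>f g. schwartz f \<longrightarrow> schwartz g \<longrightarrow> u (\<lambda>x. f x + g x) = u f + u g) \<and>
     (\<forall>k f. schwartz f \<longrightarrow> u (\<lambda>x. k * f x) = k * u f) \<and>
     (\<exists>C N. \<forall>f. schwartz f \<longrightarrow> norm (u f) \<le> C * schwartz_seminorm N f)"

definition nonzero_distribution :: "'a::euclidean_space functional \<Rightarrow> bool" where
  "nonzero_distribution u \<longleftrightarrow> (\<exists>f. schwartz f \<and> u f \<noteq> 0)"

definition point_mass :: "'a \<Rightarrow> 'a functional" where
  "point_mass \<xi> f = f \<xi>"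

definition conj_distribution :: "'a functional \<Rightarrow> 'a functional" where
  "conj_distribution u f = cnj (u (\<lambda>x. cnj (f x)))"

definition tensor_distribution ::
    "'a functional \<Rightarrow> 'b functional \<Rightarrow> ('a \<times> 'b) functional" where
  "tensor_distribution u v F = u (\<lambda>x. v (\<lambda>y. F (x, y)))"

definition det2 :: "(real \<times> real \<Rightarrow> real \<times> real) \<Rightarrow> real" where
  "det2 T = fst (T (1, 0)) * snd (T (0, 1)) - fst (T (0, 1)) * snd (T (1, 0))"

text \<open>The extension of composition with \<open>T\<close> to distributions: by the change of variables
  formula, the integral of \<open>(F \<circ> T) * f\<close> equals that of \<open>F * (f \<circ> inv T)\<close> divided by
  the absolute value of the determinant.\<close>

definition pullback ::
    "(real \<times> real \<Rightarrow> real \<times> real) \<Rightarrow> (real \<times> real) functional \<Rightarrow> (real \<times> real) functional" where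
  "pullback T U f = U (\<lambda>z. f (inv T z)) / complex_of_real \<bar>det2 T\<bar>"

definition partial_fourier :: "(real \<times> real \<Rightarrow> complex) \<Rightarrow> real \<times> real \<Rightarrow> complex" where
  "partial_fourier F =
     (\<lambda>(x, \<omega>). LINT t|lborel. F (x, t) * exp (- 2 * complex_of_real pi * \<i> *
        complex_of_real \<omega> * complex_of_real t))"

text \<open>The partial Fourier transform is its own transpose for the bilinear pairing.\<close>

definition partial_fourier_distribution ::
    "(real \<times> real) functional \<Rightarrow> (real \<times> real) functional" where
  "partial_fourier_distribution U f = U (partial_fourier f)"

definition matrix_wigner ::
    "(real \<times> real \<Rightarrow> real \<times> real) \<Rightarrow> real functional \<Rightarrow> real functional \<Rightarrow>
     (real \<times> real) functional" where
  "matrix_wigner T \<mu> \<nu> =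
     partial_fourier_distribution (pullback T (tensor_distribution \<mu> (conj_distribution \<nu>)))"

definition distribution_support :: "'a::euclidean_space functional \<Rightarrow> 'a set" where
  "distribution_support u =
     {x. \<forall>U. open U \<longrightarrow> x \<in> U \<longrightarrow>
        (\<exists>f. test_function f \<and> closure {y. f y \<noteq> 0} \<subseteq> U \<and> u f \<noteq> 0)}"


section \<open>Locally finite complex Borel measures\<close>

text \<open>Such a measure is in general only defined on bounded Borel sets; the values of the set
  function elsewhere are irrelevant.\<close>

definition locally_finite_complex_measure :: "('a::euclidean_space set \<Rightarrow> complex) \<Rightarrow> bool" where
  "locally_finite_complex_measure m \<longleftrightarrow>
     (\<forall>E :: nat \<Rightarrow> 'a set. range E \<subseteq> sets borel \<longrightarrow> disjoint_family E \<longrightarrow> bounded (\<Union>i. E i) \<longrightarrow>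
        (\<lambda>i. m (E i)) sums m (\<Union>i. E i))"

definition locally_finite_borel :: "'a::euclidean_space measure \<Rightarrow> bool" where
  "locally_finite_borel M \<longleftrightarrow>
     sets M = sets borel \<and> (\<forall>E \<in> sets borel. bounded E \<longrightarrow> emeasure M E < \<infinity>)"

text \<open>The integral against \<open>m\<close> via a decomposition \<open>m = P1 - P2 + \<i> (Q1 - Q2)\<close> into positive
  locally finite measures; for a bounded Borel function of bounded support the value does not
  depend on the decomposition.\<close>

definition has_complex_measure_integral ::
    "('a::euclidean_space set \<Rightarrow> complex) \<Rightarrow> ('a \<Rightarrow> complex) \<Rightarrow> complex \<Rightarrow> bool" where
  "has_complex_measure_integral m f I \<longleftrightarrow>
     (\<exists>P1 P2 Q1 Q2.
        (\<forall>M \<in> {P1, P2, Q1, Q2}. locally_finite_borel M \<and> integrable M f) \<and>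
        (\<forall>E \<in> sets borel. bounded E \<longrightarrow>
           m E = Complex (measure P1 E - measure P2 E) (measure Q1 E - measure Q2 E)) \<and>
        I = (LINT x|P1. f x) - (LINT x|P2. f x) + \<i> * ((LINT x|Q1. f x) - (LINT x|Q2. f x)))"

text \<open>The identity is required on compactly supported test functions, which are dense in the
  Schwartz space; a Schwartz function need not be absolutely integrable against a locally
  finite measure that happens to define a tempered distribution.\<close>

definition given_by_measure :: "'a::euclidean_space functional \<Rightarrow> bool" where
  "given_by_measure u \<longleftrightarrow>
     (\<exists>m. locally_finite_complex_measure m \<and>
        (\<forall>f. test_function f \<longrightarrow> has_complex_measure_integral m f (u f)))"

end

theory Submission
  imports Defs "HOL-Probability.Characteristic_Functions" "HOL-Probability.Sinc_Integral"
begin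

text \<open>
  Write \<open>u = \<mu>\<close> and let \<open>v\<close> be the complex conjugate of \<open>\<nu>\<close>.  In the coordinates \<open>(x, t)\<close>
  given by \<open>T\<close>, the tensor product of \<open>u\<close> and \<open>v\<close> differs from its Wigner transform only by a
  Fourier transform in \<open>t\<close>, which leaves \<open>x\<close> untouched.  A sum of point masses on \<open>A \<times> B\<close>
  annihilates all functions that vanish on \<open>A \<times> \<real>\<close>; undoing the Fourier transform, the tensor
  product annihilates every test function that vanishes on the lines \<open>a * x + b * y \<in> A\<close>
  (\<open>matrix_wigner_test_function\<close>).  This is where the shape of the series enters: it says not only
  that the support lies on these lines but also that there are no derivatives across them.

  Now let \<open>\<phi>\<close> and \<open>\<psi>\<close> have supports so small that only one of the lines, with value \<open>r\<close>, meets
  the product of the supports.  The test function \<open>(a * x + b * y - r) * \<phi> x * \<psi> y\<close> is annihilated,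
  which says
  \<open>a * u (x * \<phi>) * v \<psi> + b * u \<phi> * v (y * \<psi>) = r * u \<phi> * v \<psi>\<close>.
  Keep one \<open>\<psi>\<close> with \<open>v \<psi> \<noteq> 0\<close>.  Then \<open>u (x * \<phi>) = \<kappa> * u \<phi>\<close> for a constant \<open>\<kappa>\<close>, so \<open>u\<close> annihilates
  all multiples of \<open>x - \<kappa>\<close> on a short interval.  Every test function vanishing at \<open>\<kappa>\<close> is such a
  multiple, hence on the interval \<open>u\<close> is a multiple of the point mass at \<open>\<kappa>\<close>, or zero if \<open>\<kappa>\<close> is not
  a real point of the interval (\<open>locally_point_mass_if_collinear\<close>).

  The length of the interval depends only on the separation of \<open>A\<close> and on \<open>a\<close>, \<open>b\<close>, not on its
  position.  Consequently the support of \<open>u\<close> is uniformly discrete, and a smooth partition of unity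
  gives \<open>u \<phi> = (\<Sum>x\<in>S. w x * \<phi> x)\<close> for all test functions
  (\<open>locally_point_mass_discrete_sum\<close>), which is integration against a locally finite measure.
  The relation is symmetric in \<open>(u, a)\<close> and \<open>(v, b)\<close>, so the same holds for \<open>v\<close> and thus for \<open>\<nu>\<close>.
\<close>

section \<open>Smooth functions\<close>

definition partial_deriv :: "'a::euclidean_space \<Rightarrow> ('a \<Rightarrow> complex) \<Rightarrow> 'a \<Rightarrow> complex" where
  "partial_deriv v f = (\<lambda>x. frechet_derivative f (at x) v)"

lemma iterated_partial_Nil [simp]: "iterated_partial [] f = f"
  by (simp add: iterated_partial_def)

lemma iterated_partial_Cons: "iterated_partial (v # vs) f = partial_deriv v (iterated_partial vs f)"
  by (simp add: iterated_partial_def partial_deriv_def)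

lemma iterated_partial_snoc: "iterated_partial (vs @ [v]) f = iterated_partial vs (partial_deriv v f)"
  by (simp add: iterated_partial_def partial_deriv_def)

lemma partial_deriv_eqI:
  "(\<And>x. (f has_derivative f' x) (at x)) \<Longrightarrow> partial_deriv v f = (\<lambda>x. f' x v)"
  unfolding partial_deriv_def using frechet_derivative_at by (metis (no_types))

lemma smooth_differentiable: "smooth f \<Longrightarrow> f differentiable (at x)"
  unfolding smooth_def by (metis empty_subsetI iterated_partial_Nil list.set(1))

lemma smooth_has_derivative:
  "smooth f \<Longrightarrow> (f has_derivative (\<lambda>v. partial_deriv v f x)) (at x)"
  using smooth_differentiable frechet_derivative_works unfolding partial_deriv_def by blast

lemma smooth_continuous: "smooth f \<Longrightarrow> continuous_on S f"
  by (meson continuous_at_imp_continuous_on differentiable_imp_continuous_within smooth_differentiable)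

lemma smooth_partial_deriv: "smooth f \<Longrightarrow> v \<in> Basis \<Longrightarrow> smooth (partial_deriv v f)"
  unfolding smooth_def by (metis Un_insert_right append.right_neutral insert_subset
      iterated_partial_snoc list.simps(15) set_append)

lemma iterated_partial_coinduct:
  assumes "P f" and "\<And>f v. P f \<Longrightarrow> v \<in> Basis \<Longrightarrow> P (partial_deriv v f)"
  shows "set vs \<subseteq> Basis \<Longrightarrow> P (iterated_partial vs f)"
  by (induction vs) (use assms in \<open>auto simp: iterated_partial_Cons\<close>)

text \<open>The working principle for smoothness: it is enough to find a class of differentiable
  functions that contains the given one and is closed under partial derivatives.  No derivative has to
  be computed in closed form.\<close>

lemma smooth_coinduct:
  assumes "P f" and "\<And>f x. P f \<Longrightarrow> f differentiable (at x)"
    and "\<And>f v. P f \<Longrightarrow> v \<in> Basis \<Longrightarrow> P (partial_deriv v f)"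
  shows "smooth f"
  unfolding smooth_def using iterated_partial_coinduct[of P f] assms by blast

lemma smooth_const [simp]: "smooth (\<lambda>x. c)"
proof (rule smooth_coinduct[where P = "\<lambda>f. \<exists>c. f = (\<lambda>x. c)"])
  fix f :: "'a \<Rightarrow> complex" and v :: 'a assume "\<exists>c. f = (\<lambda>x. c)"
  then show "\<exists>c. partial_deriv v f = (\<lambda>x. c)"
    by (auto simp: partial_deriv_def)
qed auto

text \<open>The algebra generated by the smooth functions on the domain of a fixed map \<open>h\<close> and by the
  composites of \<open>h\<close> with smooth functions.  For
  smooth \<open>h\<close> the chain, product and quotient rules keep the derivatives inside this algebra, so that
  coinduction yields all closure properties of smooth functions at once.\<close>

inductive smooth_closure :: "('a::euclidean_space \<Rightarrow> 'b::euclidean_space) \<Rightarrow> ('a \<Rightarrow> complex) \<Rightarrow> bool"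
  for h where
  base: "smooth f \<Longrightarrow> smooth_closure h f"
| comp: "smooth g \<Longrightarrow> smooth_closure h (\<lambda>x. g (h x))"
| add: "smooth_closure h f \<Longrightarrow> smooth_closure h g \<Longrightarrow> smooth_closure h (\<lambda>x. f x + g x)"
| mult: "smooth_closure h f \<Longrightarrow> smooth_closure h g \<Longrightarrow> smooth_closure h (\<lambda>x. f x * g x)"
| inverse: "smooth_closure h f \<Longrightarrow> (\<And>x. f x \<noteq> 0) \<Longrightarrow> smooth_closure h (\<lambda>x. inverse (f x))"
| cnj: "smooth_closure h f \<Longrightarrow> smooth_closure h (\<lambda>x. cnj (f x))"

lemma smooth_closure_sum:
  "finite I \<Longrightarrow> (\<And>i. i \<in> I \<Longrightarrow> smooth_closure h (f i)) \<Longrightarrow> smooth_closure h (\<lambda>x. \<Sum>i\<in>I. f i x)"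
  by (induction rule: finite_induct) (simp_all add: smooth_closure.base smooth_closure.add)

text \<open>Each rule of the closure is matched by a differentiation rule.  The class contains the
  functions themselves besides their composites with \<open>h\<close> because the chain rule produces factors
  that are derivatives of the coordinates of \<open>h\<close>.\<close>

lemma smooth_closure_imp_smooth:
  fixes h :: "'a::euclidean_space \<Rightarrow> 'b::euclidean_space"
  assumes h: "\<And>b. b \<in> Basis \<Longrightarrow> smooth (\<lambda>x. complex_of_real (h x \<bullet> b))"
  assumes "smooth_closure h f"
  shows "smooth f"
proof (rule smooth_coinduct[where P = "smooth_closure h"])
  have h': "(h has_derivative (\<lambda>v. \<Sum>b\<in>Basis. Re (partial_deriv v (\<lambda>x. complex_of_real (h x \<bullet> b)) x) *\<^sub>R b)) (at x)"
    (is "(h has_derivative ?h x) (at x)") for x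
  proof -
    have "((\<lambda>x. \<Sum>b\<in>Basis. Re (complex_of_real (h x \<bullet> b)) *\<^sub>R b) has_derivative ?h x) (at x)"
      by (intro has_derivative_sum has_derivative_scaleR_left bounded_linear.has_derivative[OF bounded_linear_Re]
          smooth_has_derivative h)
    then show ?thesis
      by (simp add: euclidean_representation)
  qed
  have *: "\<exists>f'. (\<forall>x. (f has_derivative f' x) (at x)) \<and> (\<forall>v\<in>Basis. smooth_closure h (\<lambda>x. f' x v))"
    if "smooth_closure h f" for f
    using that
  proof induction
    case (base f)
    then show ?case
      by (intro exI[of _ "\<lambda>x v. partial_deriv v f x"] conjI allI ballI smooth_has_derivative
          smooth_closure.base smooth_partial_deriv)
  next
    case (comp g)
    let ?g = "\<lambda>y v. partial_deriv v g y"
    have d: "((\<lambda>x. g (h x)) has_derivative (\<lambda>v. ?g (h x) (?h x v))) (at x)" for x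
      using has_derivative_compose[OF h' smooth_has_derivative[OF comp]] .
    have eq: "?g y (?h x v) = (\<Sum>b\<in>Basis. complex_of_real (Re (partial_deriv v (\<lambda>x. complex_of_real (h x \<bullet> b)) x)) * partial_deriv b g y)" for x y v
    proof -
      have "linear (?g y)"
        using has_derivative_linear[OF smooth_has_derivative[OF comp]] .
      then show ?thesis
        by (simp only: linear_sum[OF \<open>linear (?g y)\<close>] linear_scale[OF \<open>linear (?g y)\<close>] scaleR_conv_of_real)
    qed
    \<comment> \<open>The real part is expressed by operations under which the class is closed.\<close>
    have re: "complex_of_real (Re z) = (z + cnj z) * inverse 2" for z
      by (simp add: complex_eq_iff)
    have "smooth_closure h (\<lambda>x. ?g (h x) (?h x v))" if v: "v \<in> Basis" for v
      unfolding eq re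
      by (intro smooth_closure_sum smooth_closure.intros smooth_partial_deriv h v comp smooth_const) auto
    with d show ?case by (intro exI[of _ "\<lambda>x v. ?g (h x) (?h x v)"]) blast
  next
    case (add f g)
    then obtain f' g' where "\<forall>x. (f has_derivative f' x) (at x)" "\<forall>v\<in>Basis. smooth_closure h (\<lambda>x. f' x v)"
      "\<forall>x. (g has_derivative g' x) (at x)" "\<forall>v\<in>Basis. smooth_closure h (\<lambda>x. g' x v)" by blast
    then show ?case
      by (intro exI[of _ "\<lambda>x v. f' x v + g' x v"] conjI allI ballI smooth_closure.add has_derivative_add) auto
  next
    case (mult f g)
    then obtain f' g' where "\<forall>x. (f has_derivative f' x) (at x)" "\<forall>v\<in>Basis. smooth_closure h (\<lambda>x. f' x v)"
      "\<forall>x. (g has_derivative g' x) (at x)" "\<forall>v\<in>Basis. smooth_closure h (\<lambda>x. g' x v)" by blast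
    then show ?case using mult.hyps
      by (intro exI[of _ "\<lambda>x v. f x * g' x v + f' x v * g x"] conjI allI ballI smooth_closure.add smooth_closure.mult has_derivative_mult) auto
  next
    case (inverse f)
    then obtain f' where "\<forall>x. (f has_derivative f' x) (at x)" "\<forall>v\<in>Basis. smooth_closure h (\<lambda>x. f' x v)"
      by blast
    moreover have "smooth_closure h (\<lambda>x. (-1) * (inverse (f x) * f' x v * inverse (f x)))" if "v \<in> Basis" for v
      using calculation that inverse by (intro smooth_closure.mult smooth_closure.inverse smooth_closure.base[OF smooth_const]) auto
    ultimately show ?case using inverse.hyps
      by (intro exI[of _ "\<lambda>x v. - (inverse (f x) * f' x v * inverse (f x))"] conjI allI ballI Deriv.has_derivative_inverse) auto
  next
    case (cnj f)
    then obtain f' where "\<forall>x. (f has_derivative f' x) (at x)" "\<forall>v\<in>Basis. smooth_closure h (\<lambda>x. f' x v)"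
      by blast
    then show ?case
      by (intro exI[of _ "\<lambda>x v. cnj (f' x v)"] conjI allI ballI smooth_closure.cnj has_derivative_cnj) auto
  qed
  show "f differentiable (at x)" if "smooth_closure h f" for f x
    using *[OF that] by (auto simp: differentiable_def)
  show "smooth_closure h (partial_deriv v f)" if f: "smooth_closure h f" and v: "v \<in> Basis" for f v
  proof -
    obtain f' where f': "\<forall>x. (f has_derivative f' x) (at x)" "\<forall>v\<in>Basis. smooth_closure h (\<lambda>x. f' x v)"
      using *[OF f] by blast
    then have "partial_deriv v f = (\<lambda>x. f' x v)"
      by (intro partial_deriv_eqI) auto
    with f' v show ?thesis by auto
  qed
qed (fact assms)

lemma smooth_compose:
  fixes h :: "'a::euclidean_space \<Rightarrow> 'b::euclidean_space"
  assumes "\<And>b. b \<in> Basis \<Longrightarrow> smooth (\<lambda>x. complex_of_real (h x \<bullet> b))" and "smooth g"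
  shows "smooth (\<lambda>x. g (h x))"
  using smooth_closure_imp_smooth[OF assms(1) smooth_closure.comp[OF assms(2)]] by blast

lemma smooth_compose_real:
  fixes h :: "'a::euclidean_space \<Rightarrow> real"
  assumes "smooth (\<lambda>x. complex_of_real (h x))" and "smooth g"
  shows "smooth (\<lambda>x. g (h x))"
  using assms by (rule_tac smooth_compose) auto

lemma smooth_compose_Pair:
  fixes h1 :: "'a::euclidean_space \<Rightarrow> real" and h2 :: "'a \<Rightarrow> real"
  assumes "smooth (\<lambda>x. complex_of_real (h1 x))" "smooth (\<lambda>x. complex_of_real (h2 x))" and "smooth g"
  shows "smooth (\<lambda>x. g (h1 x, h2 x))"
  using assms by (rule_tac smooth_compose) (auto simp: Basis_prod_def)

lemma
  assumes "smooth f" "smooth g"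
  shows smooth_add: "smooth (\<lambda>x. f x + g x)" and smooth_mult: "smooth (\<lambda>x. f x * g x)"
  by (rule smooth_closure_imp_smooth[where h = "\<lambda>x. 0::real"];
      simp add: smooth_closure.add smooth_closure.base smooth_closure.mult assms)+

lemma smooth_cnj: "smooth f \<Longrightarrow> smooth (\<lambda>x. cnj (f x))"
  using smooth_closure_imp_smooth[where h = "\<lambda>x. 0::real", OF _ smooth_closure.cnj[OF smooth_closure.base]]
  by simp

lemma smooth_inverse: "smooth f \<Longrightarrow> (\<And>x. f x \<noteq> 0) \<Longrightarrow> smooth (\<lambda>x. inverse (f x))"
  by (rule smooth_closure_imp_smooth[where h = "\<lambda>x. 0::real", OF _ smooth_closure.inverse[OF smooth_closure.base]])
    simp_all

lemma smooth_diff: "smooth f \<Longrightarrow> smooth g \<Longrightarrow> smooth (\<lambda>x. f x - g x)"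
  using smooth_add[OF _ smooth_mult[OF smooth_const[of "-1"]], of f g] by simp

lemma smooth_sum: "finite I \<Longrightarrow> (\<And>i. i \<in> I \<Longrightarrow> smooth (f i)) \<Longrightarrow> smooth (\<lambda>x. \<Sum>i\<in>I. f i x)"
  by (induction rule: finite_induct) (simp_all add: smooth_add)

lemma smooth_bounded_linear:
  assumes "bounded_linear f"
  shows "smooth f"
proof (rule smooth_coinduct[where P = "\<lambda>f. bounded_linear f \<or> (\<exists>c. f = (\<lambda>x. c))"])
  show "f differentiable (at x)" if "bounded_linear f \<or> (\<exists>c. f = (\<lambda>x. c))" for f :: "'a \<Rightarrow> complex" and x
    using that bounded_linear_imp_differentiable by auto
  show "bounded_linear (partial_deriv v f) \<or> (\<exists>c. partial_deriv v f = (\<lambda>x. c))"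
    if "bounded_linear f \<or> (\<exists>c. f = (\<lambda>x. c))" for f :: "'a \<Rightarrow> complex" and v
  proof (cases "bounded_linear f")
    case True
    then have "partial_deriv v f = (\<lambda>x. f v)"
      by (intro partial_deriv_eqI bounded_linear_imp_has_derivative)
    then show ?thesis by blast
  next
    case False
    with that show ?thesis by (auto simp: partial_deriv_def)
  qed
qed (use assms in auto)

lemma smooth_linear: "linear L \<Longrightarrow> smooth (\<lambda>x. complex_of_real (L x))"
  by (intro smooth_bounded_linear bounded_linear_compose[OF bounded_linear_of_real]) (simp add: linear_conv_bounded_linear)

lemma smooth_coord [simp]:
  "smooth (\<lambda>x. complex_of_real x)" "smooth (\<lambda>z. complex_of_real (fst z))" "smooth (\<lambda>z. complex_of_real (snd z))"
  "smooth (\<lambda>z::(real\<times>real)\<times>real. complex_of_real (fst (fst z)))"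
  "smooth (\<lambda>z::(real\<times>real)\<times>real. complex_of_real (snd (fst z)))"
  by (auto intro!: smooth_linear linear_fst linear_snd linear_compose[unfolded o_def, of fst] linear_ident)

text \<open>The multiples of \<open>cis\<close> are closed under differentiation.\<close>

lemma smooth_cis: "smooth cis"
proof (rule smooth_coinduct[where P = "\<lambda>f. \<exists>c. f = (\<lambda>x. c * cis x)"])
  have d: "((\<lambda>x. c * cis x) has_derivative (\<lambda>v. c * (v *\<^sub>R (\<i> * cis x)))) (at x)" for c x
    by (intro has_derivative_mult_right has_derivative_cis has_derivative_ident)
  show "f differentiable (at x)" if "\<exists>c. f = (\<lambda>x. c * cis x)" for f x
    using that d by (auto simp: differentiable_def)
  show "\<exists>c. partial_deriv v f = (\<lambda>x. c * cis x)" if "\<exists>c. f = (\<lambda>x. c * cis x)" for f v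
  proof -
    from that obtain c where c: "f = (\<lambda>x. c * cis x)" by blast
    have "partial_deriv v f = (\<lambda>x. c * (v *\<^sub>R (\<i> * cis x)))"
      unfolding c by (rule partial_deriv_eqI) (rule d)
    also have "\<dots> = (\<lambda>x. (c * v * \<i>) * cis x)"
      by (auto simp: scaleR_conv_of_real)
    finally show ?thesis by blast
  qed
qed (auto intro: exI[of _ 1])

lemmas smooth_intros = smooth_const smooth_add smooth_mult smooth_diff smooth_cnj smooth_sum smooth_coord

text \<open>Differentiation under the integral sign.  The total derivative in \<open>x\<close> depends continuously on
  \<open>(x, t)\<close> because its values on the basis vectors are smooth.\<close>

lemma has_derivative_parametric_integral:
  fixes K :: "'a::euclidean_space \<times> real \<Rightarrow> complex"
  assumes K: "smooth K"
  shows "((\<lambda>x. integral {p..q} (\<lambda>t. K (x, t))) has_derivative (\<lambda>v. integral {p..q} (\<lambda>t. partial_deriv (v, 0) K (x, t)))) (at x)"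
proof -
  define D where "D = (\<lambda>x t. Blinfun (\<lambda>v. partial_deriv (v, 0) K (x, t)))"
  have blK: "bounded_linear (\<lambda>v. partial_deriv v K z)" for z
    using has_derivative_bounded_linear[OF smooth_has_derivative[OF K]] .
  have "bounded_linear (\<lambda>v. partial_deriv (v, 0) K (x, t))" for x t
    using bounded_linear_compose[OF blK bounded_linear_Pair[OF bounded_linear_ident bounded_linear_zero]] .
  then have D: "blinfun_apply (D x t) v = partial_deriv (v, 0) K (x, t)" for x t v
    by (simp add: D_def bounded_linear_Blinfun_apply)
  have dK: "((\<lambda>x. K (x, t)) has_derivative blinfun_apply (D x t)) (at x within S)" for x t S
  proof -
    have "((\<lambda>x. (x, t)) has_derivative (\<lambda>v. (v, 0))) (at x within S)"
      by (auto intro!: derivative_eq_intros)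
    from has_derivative_compose[OF this smooth_has_derivative[OF K]] show ?thesis
      by (simp add: D[abs_def])
  qed
  have cont: "continuous_on S (\<lambda>(x, t). D x t)" for S
    unfolding case_prod_unfold
  proof (rule continuous_on_blinfun_componentwise)
    fix i :: 'a assume "i \<in> Basis"
    then have "smooth (partial_deriv (i, 0) K)"
      by (intro smooth_partial_deriv K) (simp add: Basis_prod_def)
    from smooth_continuous[OF this]
    show "continuous_on S (\<lambda>z. blinfun_apply (D (fst z) (snd z)) i)"
      by (simp add: D)
  qed
  have "((\<lambda>x. integral (cbox p q) (\<lambda>t. K (x, t))) has_derivative integral (cbox p q) (D x)) (at x within UNIV)"
  proof (rule leibniz_rule)
    show "(\<lambda>t. K (x, t)) integrable_on cbox p q" for x
      unfolding cbox_interval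
      by (intro integrable_continuous_real continuous_on_compose2[OF smooth_continuous[OF K, of UNIV]] continuous_intros) auto
  qed (simp_all add: dK cont)
  moreover have "blinfun_apply (integral (cbox p q) (D x)) = (\<lambda>v. integral {p..q} (\<lambda>t. partial_deriv (v, 0) K (x, t)))"
  proof
    fix v
    have "D x integrable_on {p..q}"
    proof (intro integrable_continuous_real)
      have "continuous_on {p..q} (\<lambda>t. case (x, t) of (x, t) \<Rightarrow> D x t)"
        by (rule continuous_on_compose2[OF cont[of UNIV]]) (auto intro!: continuous_intros)
      then show "continuous_on {p..q} (D x)" by simp
    qed
    then show "blinfun_apply (integral (cbox p q) (D x)) v = integral {p..q} (\<lambda>t. partial_deriv (v, 0) K (x, t))"
      by (simp add: blinfun_apply_integral D[symmetric])
  qed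
  ultimately show ?thesis
    by simp
qed

lemma smooth_parametric_integral:
  fixes K :: "'a::euclidean_space \<times> real \<Rightarrow> complex"
  assumes K: "smooth K"
  shows "smooth (\<lambda>x. integral {p..q} (\<lambda>t. K (x, t)))"
proof (rule smooth_coinduct[where P = "\<lambda>f. \<exists>K. smooth K \<and> f = (\<lambda>x. integral {p..q} (\<lambda>t. K (x, t)))"])
  fix f :: "'a \<Rightarrow> complex" and v :: 'a
  assume f: "\<exists>K. smooth K \<and> f = (\<lambda>x. integral {p..q} (\<lambda>t. K (x, t)))"
  show "f differentiable (at x)" for x
    using f has_derivative_parametric_integral unfolding differentiable_def by blast
  assume v: "v \<in> Basis"
  from f obtain K where K: "smooth K" "f = (\<lambda>x. integral {p..q} (\<lambda>t. K (x, t)))" by blast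
  have "partial_deriv v f = (\<lambda>x. integral {p..q} (\<lambda>t. partial_deriv (v, 0) K (x, t)))"
    unfolding K(2) by (rule partial_deriv_eqI) (rule has_derivative_parametric_integral[OF K(1)])
  moreover have "smooth (partial_deriv (v, 0) K)"
    using v by (intro smooth_partial_deriv K) (simp add: Basis_prod_def)
  ultimately show "\<exists>K. smooth K \<and> partial_deriv v f = (\<lambda>x. integral {p..q} (\<lambda>t. K (x, t)))"
    by blast
qed (use K in blast)

section \<open>Test functions and Schwartz functions\<close>

lemma test_function_iff:
  fixes f :: "'a::euclidean_space \<Rightarrow> complex"
  shows "test_function f \<longleftrightarrow> smooth f \<and> (\<exists>R. \<forall>x. norm x \<ge> R \<longrightarrow> f x = 0)"
proof -
  have "compact (closure {x. f x \<noteq> 0}) \<longleftrightarrow> bounded {x. f x \<noteq> 0}"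
    by simp
  also have "\<dots> \<longleftrightarrow> (\<exists>R. \<forall>x. norm x \<ge> R \<longrightarrow> f x = 0)"
  proof
    assume "bounded {x. f x \<noteq> 0}"
    then obtain R where R: "\<And>x. f x \<noteq> 0 \<Longrightarrow> norm x \<le> R" by (auto simp: bounded_iff)
    show "\<exists>R. \<forall>x. norm x \<ge> R \<longrightarrow> f x = 0"
      by (rule exI[of _ "R + 1"]) (use R in force)
  next
    assume "\<exists>R. \<forall>x. norm x \<ge> R \<longrightarrow> f x = 0"
    then obtain R where "\<And>x. norm x \<ge> R \<Longrightarrow> f x = 0" by blast
    then have "\<And>x. f x \<noteq> 0 \<Longrightarrow> norm x \<le> R" by force
    then show "bounded {x. f x \<noteq> 0}" by (auto simp: bounded_iff)
  qed
  finally show ?thesis by (simp add: test_function_def)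
qed

lemma test_functionI: "smooth f \<Longrightarrow> (\<And>x. norm x \<ge> R \<Longrightarrow> f x = 0) \<Longrightarrow> test_function f"
  by (auto simp: test_function_iff)

lemma test_functionE:
  assumes "test_function f"
  obtains R where "R > 0" "\<And>x. norm x \<ge> R \<Longrightarrow> f x = 0"
proof -
  obtain R where R: "\<And>x. norm x \<ge> R \<Longrightarrow> f x = 0"
    using assms by (auto simp: test_function_iff)
  show ?thesis by (rule that[of "max R 1"]) (auto intro: R)
qed

lemma test_function_smooth: "test_function f \<Longrightarrow> smooth f"
  by (simp add: test_function_def)


text \<open>Differentiation does not enlarge supports.\<close>

lemma partial_deriv_zero_on_open:
  assumes "open U" "\<And>x. x \<in> U \<Longrightarrow> f x = 0" "x \<in> U"
  shows "partial_deriv v f x = 0"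
proof -
  have "((\<lambda>x. 0) has_derivative (\<lambda>v. 0)) (at x)" by simp
  then have "(f has_derivative (\<lambda>v. 0)) (at x)"
    by (rule has_derivative_transform_within_open) (use assms in auto)
  then show ?thesis
    unfolding partial_deriv_def by (metis frechet_derivative_at)
qed

lemma test_function_partial_deriv:
  assumes f: "test_function f" and v: "v \<in> Basis"
  shows "test_function (partial_deriv v f)"
proof -
  obtain R where R: "\<And>x. norm x \<ge> R \<Longrightarrow> f x = 0" using f by (auto simp: test_function_iff)
  show ?thesis
  proof (rule test_functionI)
    show "smooth (partial_deriv v f)" by (intro smooth_partial_deriv test_function_smooth f v)
    fix x :: 'a assume x: "norm x \<ge> R + 1"
    moreover have "open {x::'a. norm x > R}"
      by (intro open_Collect_less continuous_intros)
    ultimately show "partial_deriv v f x = 0"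
      by (intro partial_deriv_zero_on_open[of "{x. norm x > R}"]) (use R in auto)
  qed
qed

lemma test_function_mult:
  "smooth f \<Longrightarrow> test_function g \<Longrightarrow> test_function (\<lambda>x. f x * g x)"
  "test_function f \<Longrightarrow> smooth g \<Longrightarrow> test_function (\<lambda>x. f x * g x)"
  by (auto simp: test_function_iff intro: smooth_mult)

lemma test_function_cnj: "test_function f \<Longrightarrow> test_function (\<lambda>x. cnj (f x))"
  by (auto simp: test_function_iff intro: smooth_cnj)

lemma test_function_0 [simp]: "test_function (\<lambda>x. 0)"
  by (auto simp: test_function_iff)

lemma test_function_add:
  assumes "test_function f" "test_function g"
  shows "test_function (\<lambda>x. f x + g x)"
proof -
  obtain R where R: "\<And>x. norm x \<ge> R \<Longrightarrow> f x = 0"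
    using assms(1) by (auto simp: test_function_iff)
  obtain R' where R': "\<And>x. norm x \<ge> R' \<Longrightarrow> g x = 0"
    using assms(2) by (auto simp: test_function_iff)
  show ?thesis
    by (rule test_functionI[of _ "max R R'"])
      (use assms R R' in \<open>auto intro: smooth_add test_function_smooth\<close>)
qed

lemma test_function_sum:
  "finite I \<Longrightarrow> (\<And>i. i \<in> I \<Longrightarrow> test_function (f i)) \<Longrightarrow> test_function (\<lambda>x. \<Sum>i\<in>I. f i x)"
  by (induction rule: finite_induct) (simp_all add: test_function_add)

text \<open>As for smoothness, with rapid decay of each member of the class added.\<close>

lemma schwartz_coinduct:
  assumes "P f" and diff: "\<And>f x. P f \<Longrightarrow> f differentiable (at x)"
    and step: "\<And>f v. P f \<Longrightarrow> v \<in> Basis \<Longrightarrow> P (partial_deriv v f)"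
    and bound: "\<And>f N. P f \<Longrightarrow> \<exists>C. \<forall>x. (1 + norm x) ^ N * norm (f x) \<le> C"
  shows "schwartz f"
  unfolding schwartz_def
proof (intro conjI allI impI)
  show "smooth f" using smooth_coinduct[of P] assms by blast
  fix vs :: "'a list" and N assume "set vs \<subseteq> Basis"
  then have "P (iterated_partial vs f)"
    using iterated_partial_coinduct[of P] assms by blast
  from bound[OF this, of N]
  show "bounded (range (\<lambda>x. (1 + norm x) ^ N *\<^sub>R iterated_partial vs f x))"
    by (auto simp: bounded_iff)
qed

lemma schwartz_smooth: "schwartz f \<Longrightarrow> smooth f"
  by (simp add: schwartz_def)

lemma schwartz_bound:
  assumes "schwartz f"
  obtains C where "C \<ge> 0" "\<And>x. (1 + norm x) ^ N * norm (f x) \<le> C"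
proof -
  have "bounded (range (\<lambda>x. (1 + norm x) ^ N *\<^sub>R iterated_partial [] f x))"
    using assms unfolding schwartz_def by (metis empty_subsetI list.set(1))
  then obtain C where C: "\<And>x. (1 + norm x) ^ N * norm (f x) \<le> C"
    by (auto simp: bounded_iff)
  show ?thesis by (rule that[of "max C 0"]) (use C in \<open>auto simp: le_max_iff_disj\<close>)
qed

lemma schwartz_partial_deriv:
  assumes "schwartz f" "v \<in> Basis"
  shows "schwartz (partial_deriv v f)"
  unfolding schwartz_def
proof (intro conjI allI impI)
  show "smooth (partial_deriv v f)"
    using assms by (intro smooth_partial_deriv schwartz_smooth)
  fix vs :: "'a list" and N assume "set vs \<subseteq> Basis"
  then have "set (vs @ [v]) \<subseteq> Basis" using assms by simp
  then show "bounded (range (\<lambda>x. (1 + norm x) ^ N *\<^sub>R iterated_partial vs (partial_deriv v f) x))"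
    using assms(1) unfolding schwartz_def iterated_partial_snoc[symmetric] by blast
qed

lemma test_function_schwartz:
  assumes "test_function f"
  shows "schwartz f"
proof (rule schwartz_coinduct[where P = test_function])
  show "\<exists>C. \<forall>x. (1 + norm x) ^ N * norm (f x) \<le> C" if f: "test_function f" for f :: "'a \<Rightarrow> complex" and N
  proof -
    obtain R where R: "R > 0" "\<And>x. norm x \<ge> R \<Longrightarrow> f x = 0" by (rule test_functionE[OF f]) blast
    have "compact ((\<lambda>x. (1 + norm x) ^ N * norm (f x)) ` cball 0 R)"
      by (intro compact_continuous_image continuous_intros smooth_continuous test_function_smooth f compact_cball)
    then have "bounded ((\<lambda>x. (1 + norm x) ^ N * norm (f x)) ` cball 0 R)"
      by (rule compact_imp_bounded)
    then obtain C where C: "\<And>x. norm x \<le> R \<Longrightarrow> norm ((1 + norm x) ^ N * norm (f x)) \<le> C"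
      unfolding bounded_iff by (metis imageI mem_cball_0)
    have "0 \<le> norm ((1 + norm (0::'a)) ^ N * norm (f 0))" by simp
    also have "\<dots> \<le> C" using C[of 0] R by simp
    finally have "0 \<le> C" .
    have "(1 + norm x) ^ N * norm (f x) \<le> C" for x
    proof (cases "norm x \<le> R")
      case True
      then show ?thesis using C[OF True] by simp
    next
      case False
      then show ?thesis using R(2)[of x] \<open>0 \<le> C\<close> by simp
    qed
    then show ?thesis by blast
  qed
qed (simp_all add: assms test_function_partial_deriv smooth_differentiable test_function_smooth)

section \<open>A smooth partition of unity\<close>

text \<open>With \<open>p = 1\<close> this is the classical function \<open>exp (- 1 / x)\<close>, extended by \<open>0\<close>.  The polynomial
  factors make the family closed under differentiation.\<close>

definition flat_exp :: "real poly \<Rightarrow> real \<Rightarrow> complex" where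
  "flat_exp p x = (if x > 0 then complex_of_real (poly p (inverse x) * exp (- inverse x)) else 0)"

lemma poly_exp_decay: "((\<lambda>x::real. poly p x * exp (- x)) \<longlongrightarrow> 0) at_top"
proof (induction p)
  case (pCons c p)
  have "((\<lambda>x::real. poly p x * exp (- x)) \<longlongrightarrow> 0) at_top" for p :: "real poly"
  proof -
    have "((\<lambda>x::real. (\<Sum>i\<le>degree p. coeff p i * (x ^ i / exp x))) \<longlongrightarrow> (\<Sum>i\<le>degree p. coeff p i * 0)) at_top"
      by (intro tendsto_sum tendsto_mult tendsto_const tendsto_power_div_exp_0)
    then show ?thesis
      by (simp add: poly_altdef sum_distrib_right exp_minus divide_inverse mult.assoc)
  qed
  then show ?case by blast
qed simp

text \<open>Away from \<open>0\<close> this is the chain rule; at \<open>0\<close> the exponential decay beats every power of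
  \<open>1 / x\<close>, so that the difference quotients tend to \<open>0\<close>.\<close>

lemma flat_exp_has_derivative:
  "(flat_exp p has_vector_derivative flat_exp ([:0, 0, 1:] * (p - pderiv p)) x) (at x)"
proof -
  consider "x > 0" | "x < 0" | "x = 0" by linarith
  then show ?thesis
  proof cases
    case 1
    have "((\<lambda>x. poly p (inverse x) * exp (- inverse x)) has_real_derivative
       inverse (x\<^sup>2) * (poly p (inverse x) - poly (pderiv p) (inverse x)) * exp (- inverse x)) (at x)"
      using 1 by (auto intro!: derivative_eq_intros poly_DERIV DERIV_chain2[OF poly_DERIV]
          simp: field_simps power2_eq_square)
    then have "((\<lambda>x. complex_of_real (poly p (inverse x) * exp (- inverse x))) has_vector_derivative
      complex_of_real (inverse (x\<^sup>2) * (poly p (inverse x) - poly (pderiv p) (inverse x)) * exp (- inverse x))) (at x)"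
      by (intro has_vector_derivative_of_real) (simp add: has_real_derivative_iff_has_vector_derivative)
    then have "(flat_exp p has_vector_derivative
      complex_of_real (inverse (x\<^sup>2) * (poly p (inverse x) - poly (pderiv p) (inverse x)) * exp (- inverse x))) (at x)"
      by (rule has_vector_derivative_transform_within_open[of _ _ _ "{0<..}"]) (use 1 in \<open>auto simp: flat_exp_def\<close>)
    then show ?thesis using 1 by (simp add: flat_exp_def power2_eq_square mult.assoc)
  next
    case 2
    have "((\<lambda>x. 0) has_vector_derivative 0) (at x)" by simp
    then have "(flat_exp p has_vector_derivative 0) (at x)"
      by (rule has_vector_derivative_transform_within_open[of _ _ _ "{..<0}"]) (use 2 in \<open>auto simp: flat_exp_def\<close>)
    then show ?thesis using 2 by (simp add: flat_exp_def)
  next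
    case 3
    have "((\<lambda>y. poly ([:0, 1:] * p) (inverse y) * exp (- inverse y)) \<longlongrightarrow> 0) (at_right 0)"
      by (rule filterlim_compose[OF poly_exp_decay filterlim_inverse_at_top_right])
    then have "((\<lambda>y. complex_of_real (poly ([:0, 1:] * p) (inverse y) * exp (- inverse y))) \<longlongrightarrow> complex_of_real 0) (at_right 0)"
      by (rule tendsto_of_real)
    then have "((\<lambda>y. flat_exp p y /\<^sub>R y) \<longlongrightarrow> 0) (at_right 0)"
      unfolding of_real_0
      by (rule Lim_transform_eventually)
        (auto simp: flat_exp_def eventually_at_right_field scaleR_conv_of_real intro!: exI[of _ 1])
    moreover have "((\<lambda>y. flat_exp p y /\<^sub>R y) \<longlongrightarrow> 0) (at_left 0)"
      by (rule Lim_transform_eventually[OF tendsto_const])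
        (auto simp: flat_exp_def eventually_at_left_field intro!: exI[of _ "-1"])
    ultimately have "((\<lambda>y. flat_exp p y /\<^sub>R y) \<longlongrightarrow> 0) (at 0)"
      by (simp add: filterlim_split_at_real)
    then have "((\<lambda>y. (flat_exp p y - flat_exp p 0 - (y - 0) *\<^sub>R 0) /\<^sub>R norm (y - 0)) \<longlongrightarrow> 0) (at 0)"
      unfolding tendsto_norm_zero_iff[symmetric, of "\<lambda>y. flat_exp p y /\<^sub>R y"]
      by (subst tendsto_norm_zero_iff[symmetric]) (simp add: flat_exp_def norm_mult)
    then have "(flat_exp p has_vector_derivative 0) (at 0)"
      unfolding has_vector_derivative_def has_derivative_at_within 
      by (simp add: bounded_linear_zero)
    then show ?thesis using 3 by (simp add: flat_exp_def)
  qed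
qed

lemma smooth_flat_exp: "smooth (flat_exp p)"
proof (rule smooth_coinduct[where P = "\<lambda>f. \<exists>p. f = flat_exp p"])
  show "\<exists>q. partial_deriv v f = flat_exp q" if f: "\<exists>p. f = flat_exp p" and v: "v \<in> Basis" for f and v :: real
  proof -
    from f obtain p where "f = flat_exp p" by blast
    moreover have "partial_deriv v (flat_exp p) = (\<lambda>x. v *\<^sub>R flat_exp ([:0, 0, 1:] * (p - pderiv p)) x)"
      using flat_exp_has_derivative by (intro partial_deriv_eqI) (simp add: has_vector_derivative_def)
    moreover have "v = 1" using v by simp
    ultimately show ?thesis by auto
  qed
qed (auto simp: differentiable_def intro: flat_exp_has_derivative[unfolded has_vector_derivative_def])

text \<open>The denominator does not vanish, since \<open>x\<close> or \<open>1 - x\<close> is positive.\<close>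

definition smooth_step :: "real \<Rightarrow> complex" where
  "smooth_step x = flat_exp 1 x * inverse (flat_exp 1 x + flat_exp 1 (1 - x))"

lemma smooth_smooth_step: "smooth smooth_step"
  unfolding smooth_step_def[abs_def]
proof (intro smooth_mult smooth_inverse smooth_add)
  show "smooth (\<lambda>x. flat_exp 1 (1 - x))"
    by (rule smooth_compose_real[OF _ smooth_flat_exp])
      (simp add: smooth_diff[OF smooth_const smooth_coord(1), of 1, simplified])
  show "flat_exp 1 x + flat_exp 1 (1 - x) \<noteq> 0" for x
  proof -
    have "0 < Re (flat_exp 1 x + flat_exp 1 (1 - x))"
      by (auto simp: flat_exp_def intro: add_pos_pos)
    then show ?thesis by (metis less_irrefl zero_complex.sel(1))
  qed
qed (simp_all add: smooth_flat_exp)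

lemma smooth_step_0: "x \<le> 0 \<Longrightarrow> smooth_step x = 0"
  by (simp add: smooth_step_def flat_exp_def)

lemma smooth_step_1: "x \<ge> 1 \<Longrightarrow> smooth_step x = 1"
  by (simp add: smooth_step_def flat_exp_def)

text \<open>As a difference of consecutive steps, the integer translates of this function telescope to
  \<open>1\<close>.\<close>

definition bump :: "real \<Rightarrow> complex" where
  "bump x = smooth_step (x + 1) - smooth_step x"

lemma smooth_affine: "smooth (\<lambda>x. complex_of_real (p * x + q))"
  using smooth_add[OF smooth_mult[OF smooth_const smooth_coord(1)] smooth_const, of p q] by simp

lemma smooth_compose_affine: "smooth g \<Longrightarrow> smooth (\<lambda>x::real. g (p * x + q))"
  by (rule smooth_compose_real[where h = "\<lambda>x::real. p * x + q", OF smooth_affine])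

lemma smooth_bump: "smooth bump"
  unfolding bump_def[abs_def]
  using smooth_compose_affine[OF smooth_smooth_step, of 1 1]
  by (intro smooth_diff smooth_smooth_step) simp

lemma bump_0 [simp]: "bump 0 = 1"
  by (simp add: bump_def smooth_step_0 smooth_step_1)

lemma bump_eq_0: "\<bar>x\<bar> \<ge> 1 \<Longrightarrow> bump x = 0"
  by (auto simp: bump_def smooth_step_0 smooth_step_1 abs_if split: if_splits)

lemma sum_bump:
  fixes x :: real and M :: nat
  assumes "\<bar>x\<bar> \<le> M"
  shows "(\<Sum>j\<in>{-int M..int M}. bump (x - j)) = 1"
proof -
  have "(\<Sum>j\<in>{-int M..int m}. bump (x - j)) = smooth_step (x + M + 1) - smooth_step (x - m)" for m
  proof (induction m)
    case 0
    have "(\<Sum>j\<in>{-int k..0}. bump (x - j)) = smooth_step (x + k + 1) - smooth_step x" for k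
    proof (induction k)
      case 0
      then show ?case by (simp add: bump_def)
    next
      case (Suc k)
      have "{-int (Suc k)..0} = insert (-int (Suc k)) {-int k..0}" by auto
      then show ?case using Suc by (simp add: bump_def algebra_simps)
    qed
    then show ?case by simp
  next
    case (Suc m)
    have "{-int M..int (Suc m)} = insert (int (Suc m)) {-int M..int m}" by auto
    then show ?case using Suc by (simp add: bump_def algebra_simps)
  qed
  from this[of M] show ?thesis using assms by (simp add: smooth_step_0 smooth_step_1)
qed

section \<open>Density of test functions\<close>

lemma iterated_partial_add:
  "smooth f \<Longrightarrow> smooth g \<Longrightarrow> set vs \<subseteq> Basis \<Longrightarrow>
     iterated_partial vs (\<lambda>x. f x + g x) = (\<lambda>x. iterated_partial vs f x + iterated_partial vs g x)"
proof (induction vs arbitrary: f g rule: rev_induct)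
  case (snoc v vs)
  have "partial_deriv v (\<lambda>x. f x + g x) = (\<lambda>x. partial_deriv v f x + partial_deriv v g x)"
    by (intro partial_deriv_eqI has_derivative_add smooth_has_derivative snoc.prems)
  with snoc show ?case
    by (simp add: iterated_partial_snoc smooth_partial_deriv)
qed simp

lemma iterated_partial_cmult:
  "smooth f \<Longrightarrow> set vs \<subseteq> Basis \<Longrightarrow>
     iterated_partial vs (\<lambda>x. c * f x) = (\<lambda>x. c * iterated_partial vs f x)"
proof (induction vs arbitrary: f rule: rev_induct)
  case (snoc v vs)
  have "partial_deriv v (\<lambda>x. c * f x) = (\<lambda>x. c * partial_deriv v f x)"
    by (intro partial_deriv_eqI has_derivative_mult_right smooth_has_derivative snoc.prems)
  with snoc show ?case
    by (simp add: iterated_partial_snoc smooth_partial_deriv)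
qed simp

text \<open>The example is \<open>1 - \<theta>\<close>, where \<open>\<theta>\<close> is a cutoff function that is \<open>1\<close> near the origin.  The
  free constant \<open>c\<close> makes room for the derivatives as well, which have \<open>c = 0\<close>.\<close>

definition tail_cutoff :: "(real \<Rightarrow> complex) \<Rightarrow> bool" where
  "tail_cutoff \<eta> \<longleftrightarrow> (\<exists>c \<theta>. test_function \<theta> \<and> \<eta> = (\<lambda>x. c + \<theta> x)) \<and> (\<forall>x. \<bar>x\<bar> < 1 \<longrightarrow> \<eta> x = 0)"

lemma tail_cutoff_smooth: "tail_cutoff \<eta> \<Longrightarrow> smooth \<eta>"
  by (auto simp: tail_cutoff_def intro: smooth_add smooth_const test_function_smooth)

lemma tail_cutoff_bounded:
  assumes "tail_cutoff \<eta>"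
  obtains C where "C \<ge> 0" "\<And>x. norm (\<eta> x) \<le> C"
proof -
  obtain c \<theta> where \<eta>: "test_function \<theta>" "\<eta> = (\<lambda>x. c + \<theta> x)"
    using assms by (auto simp: tail_cutoff_def)
  obtain C where C: "C \<ge> 0" "\<And>x. (1 + norm x) ^ 0 * norm (\<theta> x) \<le> C"
    by (rule schwartz_bound[OF test_function_schwartz[OF \<eta>(1)], of 0]) blast
  show ?thesis
  proof (rule that[of "norm c + C"])
    show "norm (\<eta> x) \<le> norm c + C" for x
      using C(2)[of x] norm_triangle_ineq[of c "\<theta> x"] by (simp add: \<eta>)
  qed (use C in simp)
qed

lemma tail_cutoff_partial_deriv:
  assumes "tail_cutoff \<eta>"
  shows "tail_cutoff (partial_deriv 1 \<eta>)"
proof -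
  obtain c \<theta> where \<eta>: "test_function \<theta>" "\<eta> = (\<lambda>x. c + \<theta> x)"
    using assms by (auto simp: tail_cutoff_def)
  have "partial_deriv 1 \<eta> = (\<lambda>x. 0 + partial_deriv 1 \<theta> x)" unfolding \<eta>
    by (intro partial_deriv_eqI has_derivative_add has_derivative_const smooth_has_derivative test_function_smooth \<eta>(1))
  moreover have "test_function (partial_deriv 1 \<theta>)"
    by (intro test_function_partial_deriv \<eta>) simp
  moreover have "partial_deriv 1 \<eta> x = 0" if "\<bar>x\<bar> < 1" for x
    by (rule partial_deriv_zero_on_open[of "{-1<..<1}"]) (use assms that in \<open>auto simp: tail_cutoff_def\<close>)
  ultimately show ?thesis unfolding tail_cutoff_def by blast
qed

lemma smooth_scaled_mult:
  "smooth \<eta> \<Longrightarrow> smooth \<phi> \<Longrightarrow> smooth (\<lambda>x::real. \<eta> (x / R) * \<phi> x)"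
  using smooth_compose_affine[of \<eta> "inverse R" 0] by (intro smooth_mult) (simp_all add: field_simps)

text \<open>On the support of \<open>\<eta> (x / R)\<close> we have \<open>\<bar>x\<bar> \<ge> R\<close>, where one more power of the weight yields the
  factor \<open>1 / R\<close>.  A derivative falls either on \<open>\<eta>\<close>, which again is a tail cutoff, or on \<open>\<phi>\<close>, so
  the claim follows by induction on the number of derivatives.\<close>

lemma tail_cutoff_decay:
  fixes \<phi> :: "real \<Rightarrow> complex"
  assumes "tail_cutoff \<eta>" and "schwartz \<phi>" and "set vs \<subseteq> Basis"
  shows "\<exists>C. \<forall>R\<ge>1. \<forall>x. (1 + norm x) ^ N * norm (iterated_partial vs (\<lambda>x. \<eta> (x / R) * \<phi> x) x) \<le> C / R"
  using assms
proof (induction vs arbitrary: \<eta> \<phi> rule: rev_induct)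
  case Nil
  obtain B where B: "B \<ge> 0" "\<And>x. norm (\<eta> x) \<le> B" by (rule tail_cutoff_bounded[OF Nil(1)]) blast
  obtain C where C: "C \<ge> 0" "\<And>x. (1 + norm x) ^ Suc N * norm (\<phi> x) \<le> C"
    by (rule schwartz_bound[OF Nil(2), of "Suc N"]) blast
  have "(1 + norm x) ^ N * norm (\<eta> (x / R) * \<phi> x) \<le> (B * C) / R" if R: "R \<ge> 1" for R x
  proof (cases "\<bar>x\<bar> < R")
    case True
    then have "\<eta> (x / R) = 0" using Nil(1) R by (auto simp: tail_cutoff_def)
    then show ?thesis using B C R by simp
  next
    case False
    have "R * ((1 + norm x) ^ N * norm (\<eta> (x / R) * \<phi> x)) \<le> (1 + norm x) * ((1 + norm x) ^ N * norm (\<eta> (x / R) * \<phi> x))"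
      by (rule mult_right_mono) (use False in auto)
    also have "\<dots> = norm (\<eta> (x / R)) * ((1 + norm x) ^ Suc N * norm (\<phi> x))"
      by (simp add: norm_mult algebra_simps)
    also have "\<dots> \<le> B * C"
      by (intro mult_mono B C) simp_all
    finally show ?thesis using R by (simp add: field_simps)
  qed
  then show ?case by auto
next
  case (snoc v vs)
  have v: "v = 1" and vs: "set vs \<subseteq> Basis" using snoc.prems by auto
  note sm = tail_cutoff_smooth[OF snoc.prems(1)] schwartz_smooth[OF snoc.prems(2)]
    smooth_partial_deriv[OF tail_cutoff_smooth[OF snoc.prems(1)], of 1] smooth_partial_deriv[OF schwartz_smooth[OF snoc.prems(2)], of 1]
  obtain C1 where C1: "\<And>R x. R \<ge> 1 \<Longrightarrow>
      (1 + norm x) ^ N * norm (iterated_partial vs (\<lambda>x. partial_deriv 1 \<eta> (x / R) * \<phi> x) x) \<le> C1 / R"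
    using snoc.IH[OF tail_cutoff_partial_deriv[OF snoc.prems(1)] snoc.prems(2) vs] by blast
  obtain C2 where C2: "\<And>R x. R \<ge> 1 \<Longrightarrow>
      (1 + norm x) ^ N * norm (iterated_partial vs (\<lambda>x. \<eta> (x / R) * partial_deriv 1 \<phi> x) x) \<le> C2 / R"
    using snoc.IH[OF snoc.prems(1) schwartz_partial_deriv[OF snoc.prems(2)] vs] by auto
  have "(1 + norm x) ^ N * norm (iterated_partial (vs @ [v]) (\<lambda>x. \<eta> (x / R) * \<phi> x) x) \<le> (C1 + C2) / R"
    if R: "R \<ge> 1" for R x
  proof -
    let ?f = "\<lambda>x. partial_deriv 1 \<eta> (x / R) * \<phi> x" and ?g = "\<lambda>x. \<eta> (x / R) * partial_deriv 1 \<phi> x"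
    let ?w = "(1 + norm x) ^ N"
    have lin: "linear (\<lambda>v. partial_deriv v \<eta> y)" for y
      using has_derivative_linear[OF smooth_has_derivative[OF sm(1)]] .
    have d: "((\<lambda>x. x / R) has_derivative (\<lambda>h. h / R)) (at x)" for x
      using R by (auto intro!: derivative_eq_intros)
    have "partial_deriv 1 (\<lambda>x. \<eta> (x / R) * \<phi> x) =
      (\<lambda>x. \<eta> (x / R) * partial_deriv 1 \<phi> x + partial_deriv (1 / R) \<eta> (x / R) * \<phi> x)"
      by (intro partial_deriv_eqI has_derivative_mult smooth_has_derivative sm
            has_derivative_compose[OF d smooth_has_derivative[OF sm(1)]])
    also have "\<dots> = (\<lambda>x. ?g x + complex_of_real (1 / R) * ?f x)"
      using linear_scale[OF lin, of "1/R" 1] by (simp add: scaleR_conv_of_real)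
    finally have "iterated_partial (vs @ [v]) (\<lambda>x. \<eta> (x / R) * \<phi> x) =
        iterated_partial vs (\<lambda>x. ?g x + complex_of_real (1 / R) * ?f x)"
      by (simp only: v iterated_partial_snoc)
    also have "\<dots> = (\<lambda>x. iterated_partial vs ?g x + complex_of_real (1 / R) * iterated_partial vs ?f x)"
      by (subst iterated_partial_add)
        (use sm vs in \<open>simp_all add: iterated_partial_cmult smooth_scaled_mult smooth_mult[OF smooth_const] del: of_real_divide\<close>)
    finally have eq: "iterated_partial (vs @ [v]) (\<lambda>x. \<eta> (x / R) * \<phi> x) x =
      iterated_partial vs ?g x + complex_of_real (1 / R) * iterated_partial vs ?f x" by simp
    have "norm (complex_of_real (1 / R) * iterated_partial vs ?f x) = (1 / R) * norm (iterated_partial vs ?f x)"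
      using R by (simp add: norm_mult norm_divide)
    also have "\<dots> \<le> 1 * norm (iterated_partial vs ?f x)"
      using R by (intro mult_right_mono) auto
    finally have "norm (complex_of_real (1 / R) * iterated_partial vs ?f x) \<le> norm (iterated_partial vs ?f x)"
      by simp
    with norm_triangle_ineq[of "iterated_partial vs ?g x" "complex_of_real (1 / R) * iterated_partial vs ?f x"]
    have "norm (iterated_partial (vs @ [v]) (\<lambda>x. \<eta> (x / R) * \<phi> x) x) \<le>
       norm (iterated_partial vs ?g x) + norm (iterated_partial vs ?f x)"
      unfolding eq by linarith
    then have "?w * norm (iterated_partial (vs @ [v]) (\<lambda>x. \<eta> (x / R) * \<phi> x) x) \<le>
       ?w * (norm (iterated_partial vs ?g x) + norm (iterated_partial vs ?f x))"
      by (intro mult_left_mono) auto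
    then show ?thesis
      using C1[OF R, of x] C2[OF R, of x] by (simp add: add_divide_distrib distrib_left)
  qed
  then show ?case by blast
qed

text \<open>Test functions are dense in the Schwartz space: a functional vanishing on them takes the same
  value on \<open>\<phi>\<close> and on \<open>\<eta> (x / R) * \<phi> x\<close> for all \<open>R\<close>, and the seminorms of the latter tend to \<open>0\<close>.\<close>

lemma nonzero_distribution_test_function:
  fixes u :: "real functional"
  assumes u: "tempered_distribution u" and nz: "nonzero_distribution u"
  shows "\<exists>\<phi>. test_function \<phi> \<and> u \<phi> \<noteq> 0"
proof (rule ccontr)
  assume "\<not> (\<exists>\<phi>. test_function \<phi> \<and> u \<phi> \<noteq> 0)"
  then have zero: "\<And>\<phi>. test_function \<phi> \<Longrightarrow> u \<phi> = 0" by blast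
  obtain \<phi> where \<phi>: "schwartz \<phi>" "u \<phi> \<noteq> 0" using nz by (auto simp: nonzero_distribution_def)
  obtain C N where C: "\<And>f. schwartz f \<Longrightarrow> norm (u f) \<le> C * schwartz_seminorm N f"
    using u unfolding tempered_distribution_def by blast
  have add: "\<And>f g. schwartz f \<Longrightarrow> schwartz g \<Longrightarrow> u (\<lambda>x. f x + g x) = u f + u g"
    using u unfolding tempered_distribution_def by blast
  define \<theta> where "\<theta> = (\<lambda>x. \<Sum>j\<in>{-1..1::int}. bump (x - of_int j))"
  have \<theta>: "test_function \<theta>"
    unfolding \<theta>_def
  proof (intro test_function_sum)
    show "test_function (\<lambda>x. bump (x - of_int j))" if "j \<in> {-1..1}" for j
      by (rule test_functionI[of _ 2])
        (use that smooth_compose_affine[OF smooth_bump, of 1 "- of_int j"] in \<open>auto intro!: bump_eq_0\<close>)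
  qed simp
  have \<theta>1: "\<theta> x = 1" if "\<bar>x\<bar> \<le> 1" for x
    using sum_bump[where x = x and M = 1] that by (simp add: \<theta>_def)
  define \<eta> where "\<eta> = (\<lambda>x. 1 + (- 1) * \<theta> x)"
  have "tail_cutoff \<eta>"
    unfolding tail_cutoff_def
  proof (intro conjI allI impI exI)
    show "test_function (\<lambda>x. (- 1) * \<theta> x)" by (intro test_function_mult \<theta> smooth_const)
  qed (auto simp: \<eta>_def \<theta>1)
  note decay = tail_cutoff_decay[OF this \<phi>(1)]
  have sm: "smooth (\<lambda>x. \<eta> (x / R) * \<phi> x)" for R
    by (intro smooth_scaled_mult tail_cutoff_smooth \<open>tail_cutoff \<eta>\<close> schwartz_smooth \<phi>)
  have sch: "schwartz (\<lambda>x. \<eta> (x / R) * \<phi> x)" if R: "R \<ge> 1" for R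
    unfolding schwartz_def
  proof (intro conjI sm allI impI)
    fix vs :: "real list" and N assume "set vs \<subseteq> Basis"
    from decay[OF this, of N] R
    show "bounded (range (\<lambda>x. (1 + norm x) ^ N *\<^sub>R iterated_partial vs (\<lambda>x. \<eta> (x / R) * \<phi> x) x))"
      by (auto simp: bounded_iff)
  qed
  have u_eq: "u \<phi> = u (\<lambda>x. \<eta> (x / R) * \<phi> x)" if R: "R \<ge> 1" for R
  proof -
    have "test_function (\<lambda>x. \<theta> (x / R))"
    proof -
      obtain r where r: "r > 0" "\<And>x. norm x \<ge> r \<Longrightarrow> \<theta> x = 0" by (rule test_functionE[OF \<theta>]) blast
      show ?thesis
      proof (rule test_functionI[of _ "r * R"])
        show "smooth (\<lambda>x. \<theta> (x / R))"
          using smooth_compose_affine[OF test_function_smooth[OF \<theta>], of "inverse R" 0] by (simp add: field_simps)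
        show "\<theta> (x / R) = 0" if "norm x \<ge> r * R" for x
          using that R by (intro r) (simp add: field_simps)
      qed
    qed
    then have t: "test_function (\<lambda>x. \<theta> (x / R) * \<phi> x)"
      by (intro test_function_mult schwartz_smooth \<phi>)
    have "\<phi> = (\<lambda>x. \<theta> (x / R) * \<phi> x + \<eta> (x / R) * \<phi> x)"
      by (auto simp: \<eta>_def algebra_simps)
    then have "u \<phi> = u (\<lambda>x. \<theta> (x / R) * \<phi> x + \<eta> (x / R) * \<phi> x)" by simp
    also have "\<dots> = 0 + u (\<lambda>x. \<eta> (x / R) * \<phi> x)"
      using add[OF test_function_schwartz[OF t] sch[OF R]] zero[OF t] by simp
    finally show ?thesis by simp
  qed
  let ?V = "{vs::real list. set vs \<subseteq> Basis \<and> length vs \<le> N}"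
  obtain K where K: "\<And>vs R x. set vs \<subseteq> Basis \<Longrightarrow> R \<ge> 1 \<Longrightarrow>
      (1 + norm x) ^ N * norm (iterated_partial vs (\<lambda>x. \<eta> (x / R) * \<phi> x) x) \<le> K vs / R"
    using decay[of _ N] by metis
  have fin: "finite ?V" by (rule finite_lists_length_le) simp
  have sup: "0 \<le> (SUP x. (1 + norm x) ^ N * norm (iterated_partial vs (\<lambda>x. \<eta> (x / R) * \<phi> x) x))
     \<and> (SUP x. (1 + norm x) ^ N * norm (iterated_partial vs (\<lambda>x. \<eta> (x / R) * \<phi> x) x)) \<le> K vs / R"
    if "set vs \<subseteq> Basis" "R \<ge> 1" for vs R
  proof
    note K' = K[OF that]
    have bdd: "bdd_above (range (\<lambda>x. (1 + norm x) ^ N * norm (iterated_partial vs (\<lambda>x. \<eta> (x / R) * \<phi> x) x)))"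
      using K' by (auto simp: bdd_above_def)
    show "0 \<le> (SUP x. (1 + norm x) ^ N * norm (iterated_partial vs (\<lambda>x. \<eta> (x / R) * \<phi> x) x))"
      by (rule cSUP_upper2[OF bdd UNIV_I[of 0]]) simp
    show "(SUP x. (1 + norm x) ^ N * norm (iterated_partial vs (\<lambda>x. \<eta> (x / R) * \<phi> x) x)) \<le> K vs / R"
      by (rule cSUP_least) (use K' in auto)
  qed
  define L where "L = (\<Sum>vs\<in>?V. K vs)"
  have bd: "norm (u \<phi>) \<le> \<bar>C\<bar> * L / R" if R: "R \<ge> 1" for R
  proof -
    let ?s = "schwartz_seminorm N (\<lambda>x. \<eta> (x / R) * \<phi> x)"
    have "0 \<le> ?s" unfolding schwartz_seminorm_def
      by (intro sum_nonneg) (use sup R in auto)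
    have "?s \<le> (\<Sum>vs\<in>?V. K vs / R)" unfolding schwartz_seminorm_def
      by (intro sum_mono) (use sup R in auto)
    also have "\<dots> = L / R" by (simp add: L_def sum_divide_distrib)
    finally have s: "?s \<le> L / R" .
    have "norm (u \<phi>) \<le> C * ?s" using C[OF sch[OF R]] u_eq[OF R] by simp
    also have "\<dots> \<le> \<bar>C\<bar> * ?s" using \<open>0 \<le> ?s\<close> by (intro mult_right_mono) auto
    also have "\<dots> \<le> \<bar>C\<bar> * (L / R)" using s by (intro mult_left_mono) auto
    finally show ?thesis by simp
  qed
  have pos: "norm (u \<phi>) > 0" using \<phi> by simp
  \<comment> \<open>For this \<open>R\<close> the bound would be at most half of \<open>norm (u \<phi>)\<close>.\<close>
  define R where "R = max 1 (2 * (\<bar>C\<bar> * L / norm (u \<phi>)))"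
  have "R \<ge> 1" "R \<ge> 2 * (\<bar>C\<bar> * L / norm (u \<phi>))" by (auto simp: R_def)
  then have "2 * (\<bar>C\<bar> * L) \<le> R * norm (u \<phi>)" using pos by (simp add: field_simps)
  moreover have "R * norm (u \<phi>) \<le> \<bar>C\<bar> * L" using bd[OF \<open>R \<ge> 1\<close>] \<open>R \<ge> 1\<close> by (simp add: field_simps)
  moreover have "R * norm (u \<phi>) > 0" using pos \<open>R \<ge> 1\<close> by simp
  ultimately show False by linarith
qed

section \<open>Division of smooth functions by linear factors\<close>

text \<open>The quotient is \<open>\<integral>\<^sub>0\<^sup>1 \<phi>'(c + s (x - c)) ds\<close>, whose smoothness follows by differentiating
  under the integral sign.\<close>

lemma hadamard:
  fixes \<phi> :: "real \<Rightarrow> complex"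
  assumes \<phi>: "smooth \<phi>" "\<phi> c = 0"
  shows "\<exists>q. smooth q \<and> (\<forall>x. \<phi> x = complex_of_real (x - c) * q x)"
proof -
  define q where "q = (\<lambda>x. integral {0..1} (\<lambda>s. partial_deriv 1 \<phi> (c + s * (x - c))))"
  have "smooth (\<lambda>x. integral {0..1} (\<lambda>s. (\<lambda>(x, s). partial_deriv 1 \<phi> (c + s * (x - c))) (x, s)))"
  proof (rule smooth_parametric_integral)
    have "smooth (\<lambda>z. complex_of_real c + complex_of_real (snd z) * (complex_of_real (fst z) - complex_of_real c))"
      by (intro smooth_intros)
    then show "smooth (\<lambda>(x, s). partial_deriv 1 \<phi> (c + s * (x - c)))"
      unfolding case_prod_unfold
      by (rule_tac smooth_compose_real[where h = "\<lambda>z. c + snd z * (fst z - c)"])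
        (simp_all add: smooth_partial_deriv \<phi>)
  qed
  then have "smooth q" by (simp add: q_def)
  moreover have "\<phi> x = complex_of_real (x - c) * q x" for x
  proof -
    have lin: "linear (\<lambda>v. partial_deriv v \<phi> y)" for y
      using has_derivative_linear[OF smooth_has_derivative[OF \<phi>(1)]] .
    have d1: "((\<lambda>s. c + s * (x - c)) has_derivative (\<lambda>h. h * (x - c))) (at s within {0..1})" for s
      by (auto intro!: derivative_eq_intros)
    have "((\<lambda>s. \<phi> (c + s * (x - c))) has_derivative (\<lambda>h. partial_deriv (h * (x - c)) \<phi> (c + s * (x - c)))) (at s within {0..1})" for s
      using has_derivative_compose[OF d1 smooth_has_derivative[OF \<phi>(1)]] .
    moreover have "partial_deriv (h * (x - c)) \<phi> y = h *\<^sub>R (complex_of_real (x - c) * partial_deriv 1 \<phi> y)" for h y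
      using linear_scale[OF lin, of "h * (x - c)" 1] by (simp add: scaleR_conv_of_real)
    ultimately have "((\<lambda>s. \<phi> (c + s * (x - c))) has_vector_derivative
        complex_of_real (x - c) * partial_deriv 1 \<phi> (c + s * (x - c))) (at s within {0..1})" for s
      by (simp add: has_vector_derivative_def)
    then have "((\<lambda>s. complex_of_real (x - c) * partial_deriv 1 \<phi> (c + s * (x - c))) has_integral
        (\<phi> (c + 1 * (x - c)) - \<phi> (c + 0 * (x - c)))) {0..1}"
      by (intro fundamental_theorem_of_calculus) auto
    then have "((\<lambda>s. complex_of_real (x - c) * partial_deriv 1 \<phi> (c + s * (x - c))) has_integral \<phi> x) {0..1}"
      using \<phi> by simp
    then have "\<phi> x = integral {0..1} (\<lambda>s. complex_of_real (x - c) * partial_deriv 1 \<phi> (c + s * (x - c)))"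
      by (rule integral_unique[symmetric])
    also have "\<dots> = complex_of_real (x - c) * q x"
      by (simp add: q_def)
    finally show ?thesis .
  qed
  ultimately show ?thesis by blast
qed

text \<open>If \<open>\<kappa>\<close> is real this is the preceding division; otherwise \<open>x - \<kappa>\<close> has no zero.  The inclusion of
  supports needs continuity of the quotient only at the single point \<open>x = \<kappa>\<close>, where vanishing of \<open>\<phi>\<close>
  gives no information.\<close>

lemma test_function_divide:
  fixes \<phi> :: "real \<Rightarrow> complex"
  assumes \<phi>: "test_function \<phi>" and zero: "\<And>x. complex_of_real x = \<kappa> \<Longrightarrow> \<phi> x = 0"
  obtains q where "test_function q" "\<And>x. \<phi> x = (complex_of_real x - \<kappa>) * q x"
    "{x. q x \<noteq> 0} \<subseteq> closure {x. \<phi> x \<noteq> 0}"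
proof -
  obtain q where q: "smooth q" "\<And>x. \<phi> x = (complex_of_real x - \<kappa>) * q x"
  proof (cases "\<exists>c. complex_of_real c = \<kappa>")
    case True
    then obtain c where c: "complex_of_real c = \<kappa>" by blast
    with hadamard[OF test_function_smooth[OF \<phi>] zero[OF c]] that show ?thesis by auto
  next
    case False
    show ?thesis
    proof (rule that[of "\<lambda>x. \<phi> x * inverse (complex_of_real x - \<kappa>)"])
      show "smooth (\<lambda>x. \<phi> x * inverse (complex_of_real x - \<kappa>))"
        using False by (intro smooth_mult smooth_inverse smooth_diff smooth_const smooth_coord(1) test_function_smooth \<phi>) auto
      show "\<phi> x = (complex_of_real x - \<kappa>) * (\<phi> x * inverse (complex_of_real x - \<kappa>))" for x
        using False by (auto simp: field_simps)
    qed
  qed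
  obtain R where R: "R > 0" "\<And>x. norm x \<ge> R \<Longrightarrow> \<phi> x = 0" by (rule test_functionE[OF \<phi>]) blast
  have q0: "q x = 0" if "\<phi> x = 0" "complex_of_real x \<noteq> \<kappa>" for x
    using q(2)[of x] that by simp
  have "test_function q"
  proof (rule test_functionI[of _ "max R (norm \<kappa> + 1)"])
    fix x :: real assume x: "norm x \<ge> max R (norm \<kappa> + 1)"
    then have "complex_of_real x \<noteq> \<kappa>" by auto
    with x show "q x = 0" by (intro q0 R) auto
  qed (fact q)
  moreover have "{x. q x \<noteq> 0} \<subseteq> closure {x. \<phi> x \<noteq> 0}"
  proof
    fix x assume x: "x \<in> {x. q x \<noteq> 0}"
    show "x \<in> closure {x. \<phi> x \<noteq> 0}"
    proof (rule ccontr)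
      assume nx: "x \<notin> closure {x. \<phi> x \<noteq> 0}"
      define W where "W = {x. q x \<noteq> 0} - closure {x. \<phi> x \<noteq> 0}"
      have "open W" unfolding W_def
        by (intro open_Diff open_Collect_neq smooth_continuous q continuous_on_const closed_closure)
      have "complex_of_real y = \<kappa>" if "y \<in> W" for y
        using that q0[of y] closure_subset[of "{x. \<phi> x \<noteq> 0}"] by (auto simp: W_def)
      then have "W \<subseteq> {x}" using x nx by (metis Diff_iff W_def of_real_eq_iff singletonI subsetI)
      moreover have "x \<in> W" using x nx by (simp add: W_def)
      ultimately have "W = {x}" by blast
      then show False using \<open>open W\<close> not_open_singleton by metis
    qed
  qed
  ultimately show ?thesis using that q by blast
qed

section \<open>Fourier inversion\<close>

lemma compact_support_integrable:
  fixes f :: "real \<Rightarrow> complex"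
  assumes "continuous_on UNIV f" and "\<And>x. x \<notin> {p..q} \<Longrightarrow> f x = 0"
  shows "integrable lborel f" and "integral {p..q} f = (LINT x|lborel. f x)"
proof -
  have "integrable lborel (\<lambda>x. indicator {p..q} x *\<^sub>R f x)"
    by (intro borel_integrable_compact continuous_on_subset[OF assms(1)]) auto
  also have "(\<lambda>x. indicator {p..q} x *\<^sub>R f x) = f"
    using assms(2) by (auto simp: indicator_def)
  finally show "integrable lborel f" .
  from has_integral_integral_lborel[OF this]
  have "(f has_integral (LINT x|lborel. f x)) {p..q}"
    by (subst has_integral_restrict_UNIV[symmetric])
      (rule has_integral_eq[rotated], assumption, use assms(2) in auto)
  then show "integral {p..q} f = (LINT x|lborel. f x)"
    by (rule integral_unique)
qed

text \<open>The Gaussian is a multiple of its own Fourier transform; this is the formula for the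
  characteristic function of the normal distribution.\<close>

lemma std_normal_density_eq_fourier:
  "complex_of_real (std_normal_density z) =
     (LINT y|lborel. complex_of_real (std_normal_density y) * cis (z * y)) / complex_of_real (sqrt (2 * pi))"
proof -
  have "complex_of_real (exp (- (z\<^sup>2) / 2)) = (CLINT y|std_normal_distribution. iexp (z * y))"
    using char_std_normal_distribution by (simp add: char_def fun_eq_iff)
  also have "\<dots> = (LINT y|lborel. std_normal_density y *\<^sub>R iexp (z * y))"
    by (subst integral_density) auto
  also have "\<dots> = (LINT y|lborel. complex_of_real (std_normal_density y) * cis (z * y))"
    by (simp add: scaleR_conv_of_real cis_conv_exp)
  finally show ?thesis
    by (simp add: std_normal_density_def)
qed

text \<open>Fourier inversion with a Gaussian damping factor: insert the Fourier representation of the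
  density on the left, exchange the integrals and rescale.\<close>

lemma gaussian_fourier_inversion:
  fixes h :: "real \<Rightarrow> complex" and \<epsilon> :: real
  assumes cont: "continuous_on UNIV h" and h: "integrable lborel h" and \<epsilon>: "\<epsilon> > 0"
  defines "H \<equiv> \<lambda>\<omega>. LINT s|lborel. h s * cis (2 * pi * \<omega> * s)"
  shows "(LINT z|lborel. complex_of_real (std_normal_density z) * h (t + \<epsilon> * z)) =
         complex_of_real (sqrt (2 * pi)) *
         (LINT \<omega>|lborel. complex_of_real (std_normal_density (2 * pi * \<epsilon> * \<omega>)) * (cis (- 2 * pi * \<omega> * t) * H \<omega>))"
proof -
  let ?n = "\<lambda>z. complex_of_real (std_normal_density z)"
  let ?s = "complex_of_real (sqrt (2 * pi))"
  have nint: "integrable lborel ?n" by (rule integrable_of_real) simp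
  have [measurable]: "h \<in> borel_measurable borel" by (rule borel_measurable_continuous_onI[OF cont])
  have [measurable]: "cis \<in> borel_measurable borel"
    by (rule borel_measurable_continuous_onI) (intro continuous_intros)
  have hint: "integrable lborel (\<lambda>z. h (t + \<epsilon> * z))"
    using lborel_integrable_real_affine[OF h, of \<epsilon> t] \<epsilon> by simp
  define g where "g = (\<lambda>(z, y). ?n y * cis (z * y) * h (t + \<epsilon> * z))"
  have "integrable (lborel \<Otimes>\<^sub>M lborel) g"
  proof (rule lborel_pair.Fubini_integrable)
    show "g \<in> borel_measurable (lborel \<Otimes>\<^sub>M lborel)" unfolding g_def by measurable
    have "(LINT y|lborel. norm (g (z, y))) = (LINT y|lborel. std_normal_density y) * norm (h (t + \<epsilon> * z))" for z
      by (simp add: g_def norm_mult)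
    then show "integrable lborel (\<lambda>z. LINT y|lborel. norm (g (z, y)))"
      using hint by simp
    show "AE z in lborel. integrable lborel (\<lambda>y. g (z, y))"
    proof (rule AE_I2)
      fix z :: real
      show "integrable lborel (\<lambda>y. g (z, y))"
        by (rule Bochner_Integration.integrable_bound[of _ "\<lambda>y. ?n y * h (t + \<epsilon> * z)"])
          (use nint in \<open>auto simp: g_def norm_mult\<close>)
    qed
  qed
  from lborel_pair.Fubini_integral[of "\<lambda>z y. g (z, y)"] this
  have fub: "(LINT y|lborel. LINT z|lborel. g (z, y)) = (LINT z|lborel. LINT y|lborel. g (z, y))"
    by (simp add: case_prod_unfold)
  have inner: "(LINT z|lborel. g (z, y)) = ?n y * (cis (- (y * t / \<epsilon>)) * H (y / (2 * pi * \<epsilon>)) / complex_of_real \<epsilon>)" for y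
  proof -
    have "H (y / (2 * pi * \<epsilon>)) = (LINT s|lborel. h s * cis (y * s / \<epsilon>))"
      by (simp add: H_def)
    also have "\<dots> = \<epsilon> *\<^sub>R (LINT z|lborel. h (t + \<epsilon> * z) * cis (y * (t + \<epsilon> * z) / \<epsilon>))"
      using lborel_integral_real_affine[of \<epsilon> "\<lambda>s. h s * cis (y * s / \<epsilon>)" t] \<epsilon> by simp
    also have "(\<lambda>z. h (t + \<epsilon> * z) * cis (y * (t + \<epsilon> * z) / \<epsilon>)) = (\<lambda>z. cis (y * t / \<epsilon>) * (cis (z * y) * h (t + \<epsilon> * z)))"
      using \<epsilon> by (simp add: fun_eq_iff cis_mult field_simps)
    also have "\<epsilon> *\<^sub>R (LINT z|lborel. cis (y * t / \<epsilon>) * (cis (z * y) * h (t + \<epsilon> * z))) =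
        complex_of_real \<epsilon> * (cis (y * t / \<epsilon>) * (LINT z|lborel. cis (z * y) * h (t + \<epsilon> * z)))"
      by (simp only: integral_mult_right_zero scaleR_conv_of_real)
    finally have "cis (- (y * t / \<epsilon>)) * H (y / (2 * pi * \<epsilon>)) =
        complex_of_real \<epsilon> * ((cis (- (y * t / \<epsilon>)) * cis (y * t / \<epsilon>)) * (LINT z|lborel. cis (z * y) * h (t + \<epsilon> * z)))"
      by (simp only: mult_ac)
    then have "(LINT z|lborel. cis (z * y) * h (t + \<epsilon> * z)) = cis (- (y * t / \<epsilon>)) * H (y / (2 * pi * \<epsilon>)) / complex_of_real \<epsilon>"
      using \<epsilon> by (simp add: cis_mult)
    then show ?thesis
      by (simp add: g_def mult.assoc)
  qed
  have "(LINT z|lborel. ?n z * h (t + \<epsilon> * z)) = (LINT z|lborel. LINT y|lborel. g (z, y)) / ?s"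
    by (subst std_normal_density_eq_fourier) (simp add: g_def)
  also have "\<dots> = (LINT y|lborel. ?n y * (cis (- (y * t / \<epsilon>)) * H (y / (2 * pi * \<epsilon>)) / complex_of_real \<epsilon>)) / ?s"
    by (simp only: fub[symmetric] inner)
  also have "\<dots> = ((2 * pi * \<epsilon>) *\<^sub>R (LINT \<omega>|lborel. ?n (2 * pi * \<epsilon> * \<omega>) * (cis (- 2 * pi * \<omega> * t) * H \<omega> / complex_of_real \<epsilon>))) / ?s"
    using lborel_integral_real_affine[of "2 * pi * \<epsilon>" "\<lambda>y. ?n y * (cis (- (y * t / \<epsilon>)) * H (y / (2 * pi * \<epsilon>)) / complex_of_real \<epsilon>)" 0] \<epsilon>
    by (simp add: mult_ac)
  also have "\<dots> = ?s * (LINT \<omega>|lborel. ?n (2 * pi * \<epsilon> * \<omega>) * (cis (- 2 * pi * \<omega> * t) * H \<omega>))"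
  proof -
    have "complex_of_real (2 * pi) = ?s * ?s"
      by (simp only: of_real_mult[symmetric] real_sqrt_mult_self) simp
    then show ?thesis using \<epsilon> by (simp add: scaleR_conv_of_real field_simps)
  qed
  finally show ?thesis .
qed

text \<open>Let the damping parameter \<open>\<epsilon>\<close> tend to \<open>0\<close> on both sides of the preceding identity; the left
  side averages \<open>h\<close> near \<open>t\<close>.\<close>

lemma fourier_inversion_compact_support:
  fixes h :: "real \<Rightarrow> complex"
  assumes cont: "continuous_on UNIV h" and supp: "\<And>x. x \<notin> {p..q} \<Longrightarrow> h x = 0"
  defines "H \<equiv> \<lambda>\<omega>. LINT s|lborel. h s * cis (2 * pi * \<omega> * s)"
  assumes H: "integrable lborel H"
  shows "(LINT \<omega>|lborel. H \<omega> * cis (- 2 * pi * \<omega> * t)) = h t"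
proof -
  let ?n = "\<lambda>z. complex_of_real (std_normal_density z)"
  let ?s = "complex_of_real (sqrt (2 * pi))"
  define \<epsilon> where "\<epsilon> = (\<lambda>k. inverse (real (Suc k)))"
  have \<epsilon>: "\<epsilon> k > 0" for k by (simp add: \<epsilon>_def)
  have \<epsilon>0: "\<epsilon> \<longlonglongrightarrow> 0" unfolding \<epsilon>_def by (rule LIMSEQ_inverse_real_of_nat)
  have hint: "integrable lborel h" by (rule compact_support_integrable[OF cont supp])
  have [measurable]: "h \<in> borel_measurable borel" by (rule borel_measurable_continuous_onI[OF cont])
  have [measurable]: "H \<in> borel_measurable borel" using H by simp
  have [measurable]: "cis \<in> borel_measurable borel"
    by (rule borel_measurable_continuous_onI) (intro continuous_intros)
  have "compact (h ` {p..q})"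
    by (intro compact_continuous_image continuous_on_subset[OF cont]) auto
  then have "bounded (h ` {p..q})" by (rule compact_imp_bounded)
  then obtain B where B: "\<forall>x\<in>{p..q}. norm (h x) \<le> B"
    by (auto simp: bounded_iff)
  have B': "norm (h x) \<le> max B 0" for x
    using bspec[OF B, of x] supp[of x] by (cases "x \<in> {p..q}") auto
  \<comment> \<open>The left side tends to \<open>h t\<close>, the right side to the undamped integral.\<close>
  have lim1: "(\<lambda>k. LINT z|lborel. ?n z * h (t + \<epsilon> k * z)) \<longlonglongrightarrow> (LINT z|lborel. ?n z * h t)"
  proof (rule integral_dominated_convergence[where w = "\<lambda>z. std_normal_density z * max B 0"])
    show "AE z in lborel. (\<lambda>k. ?n z * h (t + \<epsilon> k * z)) \<longlonglongrightarrow> ?n z * h t"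
    proof (rule AE_I2)
      fix z :: real
      have "(\<lambda>k. t + \<epsilon> k * z) \<longlonglongrightarrow> t + 0 * z"
        by (intro tendsto_intros \<epsilon>0)
      then have "(\<lambda>k. h (t + \<epsilon> k * z)) \<longlonglongrightarrow> h t"
        using continuous_on_tendsto_compose[OF cont, of "\<lambda>k. t + \<epsilon> k * z" t] by simp
      then show "(\<lambda>k. ?n z * h (t + \<epsilon> k * z)) \<longlonglongrightarrow> ?n z * h t"
        by (intro tendsto_mult tendsto_const)
    qed
    show "AE z in lborel. norm (?n z * h (t + \<epsilon> k * z)) \<le> std_normal_density z * max B 0" for k
      by (rule AE_I2) (use B' in \<open>auto simp: norm_mult intro!: mult_left_mono\<close>)
  qed auto
  have lim2: "(\<lambda>k. LINT \<omega>|lborel. ?n (2 * pi * \<epsilon> k * \<omega>) * (cis (- 2 * pi * \<omega> * t) * H \<omega>)) \<longlonglongrightarrow>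
      (LINT \<omega>|lborel. ?n 0 * (cis (- 2 * pi * \<omega> * t) * H \<omega>))"
  proof (rule integral_dominated_convergence[where w = "\<lambda>\<omega>. norm (H \<omega>)"])
    show "AE \<omega> in lborel. (\<lambda>k. ?n (2 * pi * \<epsilon> k * \<omega>) * (cis (- 2 * pi * \<omega> * t) * H \<omega>)) \<longlonglongrightarrow> ?n 0 * (cis (- 2 * pi * \<omega> * t) * H \<omega>)"
    proof (rule AE_I2)
      fix \<omega> :: real
      have "continuous_on UNIV std_normal_density"
        unfolding std_normal_density_def by (intro continuous_intros) auto
      moreover have "(\<lambda>k. 2 * pi * \<epsilon> k * \<omega>) \<longlonglongrightarrow> 2 * pi * 0 * \<omega>"
        by (intro tendsto_intros \<epsilon>0)
      ultimately have "(\<lambda>k. std_normal_density (2 * pi * \<epsilon> k * \<omega>)) \<longlonglongrightarrow> std_normal_density 0"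
        using continuous_on_tendsto_compose[of UNIV std_normal_density "\<lambda>k. 2 * pi * \<epsilon> k * \<omega>" 0] by simp
      then show "(\<lambda>k. ?n (2 * pi * \<epsilon> k * \<omega>) * (cis (- 2 * pi * \<omega> * t) * H \<omega>)) \<longlonglongrightarrow> ?n 0 * (cis (- 2 * pi * \<omega> * t) * H \<omega>)"
        by (intro tendsto_mult tendsto_of_real tendsto_const)
    qed
    show "AE \<omega> in lborel. norm (?n (2 * pi * \<epsilon> k * \<omega>) * (cis (- 2 * pi * \<omega> * t) * H \<omega>)) \<le> norm (H \<omega>)" for k
    proof (rule AE_I2)
      fix \<omega> :: real
      have n1: "std_normal_density x \<le> 1" for x
      proof -
        have "1 \<le> sqrt (2 * pi)" using pi_gt3 by (intro real_le_rsqrt) simp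
        moreover have "exp (- x\<^sup>2 / 2) \<le> 1" by simp
        ultimately have "exp (- x\<^sup>2 / 2) \<le> sqrt (2 * pi)" by linarith
        then show ?thesis using \<open>1 \<le> sqrt (2 * pi)\<close>
          by (simp add: std_normal_density_def field_simps)
      qed
      show "norm (?n (2 * pi * \<epsilon> k * \<omega>) * (cis (- 2 * pi * \<omega> * t) * H \<omega>)) \<le> norm (H \<omega>)"
        using mult_right_mono[OF n1 norm_ge_zero, of "2 * pi * \<epsilon> k * \<omega>" "H \<omega>"]
        by (simp add: norm_mult)
    qed
  qed (use H in auto)
  have "(\<lambda>k. LINT z|lborel. ?n z * h (t + \<epsilon> k * z)) \<longlonglongrightarrow>
      ?s * (LINT \<omega>|lborel. ?n 0 * (cis (- 2 * pi * \<omega> * t) * H \<omega>))"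
    unfolding gaussian_fourier_inversion[OF cont hint \<epsilon>]
    using tendsto_mult[OF tendsto_const lim2] unfolding H_def .
  from LIMSEQ_unique[OF lim1 this]
  have "(LINT z|lborel. ?n z * h t) = ?s * (LINT \<omega>|lborel. ?n 0 * (cis (- 2 * pi * \<omega> * t) * H \<omega>))" .
  moreover have "(LINT z|lborel. ?n z * h t) = h t"
  proof -
    have "(LINT z|lborel. ?n z * h t) = complex_of_real (LINT z|lborel. std_normal_density z) * h t"
      by simp
    then show ?thesis by simp
  qed
  moreover have "(LINT \<omega>|lborel. ?n 0 * (cis (- 2 * pi * \<omega> * t) * H \<omega>)) =
      ?n 0 * (LINT \<omega>|lborel. H \<omega> * cis (- 2 * pi * \<omega> * t))"
    by (simp only: integral_mult_right_zero mult.commute[of "H _"])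
  moreover have "?s * ?n 0 = 1" by (simp add: std_normal_density_def)
  ultimately show ?thesis by (simp only: mult.assoc[symmetric]) simp
qed

section \<open>Partial inverse Fourier transform of a test function\<close>

text \<open>For functions \<open>G\<close> that vanish unless \<open>\<bar>t\<bar> \<le> r\<close>, this is the inverse of \<open>partial_fourier\<close>.
  Integration over a compact interval makes it accessible to differentiation under the integral
  sign.\<close>

definition inverse_partial_fourier ::
    "real \<Rightarrow> (real \<times> real \<Rightarrow> complex) \<Rightarrow> real \<times> real \<Rightarrow> complex" where
  "inverse_partial_fourier r G =
     (\<lambda>z. integral {-r..r} (\<lambda>t. G (fst z, t) * cis (2 * pi * snd z * t)))"

lemma smooth_fourier_kernel:
  assumes "smooth G"
  shows "smooth (\<lambda>p::(real \<times> real) \<times> real. G (fst (fst p), snd p) * cis (2 * pi * snd (fst p) * snd p))"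
proof (intro smooth_mult)
  show "smooth (\<lambda>p::(real \<times> real) \<times> real. G (fst (fst p), snd p))"
    by (rule smooth_compose_Pair[where ?h1.0 = "\<lambda>p. fst (fst p)" and ?h2.0 = snd, OF smooth_coord(4) smooth_coord(3) assms])
  have "smooth (\<lambda>p::(real \<times> real) \<times> real. complex_of_real (2 * pi) * complex_of_real (snd (fst p)) * complex_of_real (snd p))"
    by (intro smooth_mult smooth_const smooth_coord)
  then show "smooth (\<lambda>p::(real \<times> real) \<times> real. cis (2 * pi * snd (fst p) * snd p))"
    by (rule_tac smooth_compose_real[where h = "\<lambda>p. 2 * pi * snd (fst p) * snd p", OF _ smooth_cis]) simp
qed

lemma smooth_inverse_partial_fourier:
  "smooth G \<Longrightarrow> smooth (inverse_partial_fourier r G)"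
  using smooth_parametric_integral[OF smooth_fourier_kernel, of G "-r" r]
  by (simp add: inverse_partial_fourier_def[abs_def])

lemma partial_deriv_inverse_partial_fourier:
  assumes G: "smooth G"
  shows "partial_deriv (1, 0) (inverse_partial_fourier r G) = inverse_partial_fourier r (partial_deriv (1, 0) G)"
    and "partial_deriv (0, 1) (inverse_partial_fourier r G) =
         inverse_partial_fourier r (\<lambda>z. (2 * pi * \<i>) * complex_of_real (snd z) * G z)"
proof -
  define K where "K = (\<lambda>p::(real \<times> real) \<times> real. G (fst (fst p), snd p) * cis (2 * pi * snd (fst p) * snd p))"
  have sK: "smooth K" unfolding K_def by (rule smooth_fourier_kernel[OF G])
  have Phi: "inverse_partial_fourier r G = (\<lambda>z. integral {-r..r} (\<lambda>t. K (z, t)))"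
    by (simp add: inverse_partial_fourier_def[abs_def] K_def)
  have d1: "((\<lambda>p::(real \<times> real) \<times> real. (fst (fst p), snd p)) has_derivative (\<lambda>v. (fst (fst v), snd v))) (at p)" for p
    by (auto intro!: derivative_eq_intros)
  have d2: "((\<lambda>p::(real \<times> real) \<times> real. 2 * pi * snd (fst p) * snd p) has_derivative
      (\<lambda>v. 2 * pi * snd (fst p) * snd v + 2 * pi * snd (fst v) * snd p)) (at p)" for p
    by (auto intro!: derivative_eq_intros simp: algebra_simps)
  have "(K has_derivative (\<lambda>v. G (fst (fst p), snd p) * ((2 * pi * snd (fst p) * snd v + 2 * pi * snd (fst v) * snd p) *\<^sub>R (\<i> * cis (2 * pi * snd (fst p) * snd p)))
      + partial_deriv (fst (fst v), snd v) G (fst (fst p), snd p) * cis (2 * pi * snd (fst p) * snd p))) (at p)" for p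
    unfolding K_def
    by (intro has_derivative_mult has_derivative_cis d2 has_derivative_compose[OF d1 smooth_has_derivative[OF G]])
  then have pK: "partial_deriv v K = (\<lambda>p. G (fst (fst p), snd p) * ((2 * pi * snd (fst p) * snd v + 2 * pi * snd (fst v) * snd p) *\<^sub>R (\<i> * cis (2 * pi * snd (fst p) * snd p)))
      + partial_deriv (fst (fst v), snd v) G (fst (fst p), snd p) * cis (2 * pi * snd (fst p) * snd p))" for v
    by (rule partial_deriv_eqI)
  have "linear (\<lambda>v. partial_deriv v G z)" for z
    using has_derivative_linear[OF smooth_has_derivative[OF G]] .
  then have p0: "partial_deriv (0, 0) G z = 0" for z
    using linear_0[of "\<lambda>v. partial_deriv v G z"] by (simp add: zero_prod_def)
  have *: "partial_deriv v (inverse_partial_fourier r G) = (\<lambda>z. integral {-r..r} (\<lambda>t. partial_deriv (v, 0) K (z, t)))" for v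
    unfolding Phi by (intro partial_deriv_eqI has_derivative_parametric_integral sK)
  show "partial_deriv (1, 0) (inverse_partial_fourier r G) = inverse_partial_fourier r (partial_deriv (1, 0) G)"
    unfolding * pK by (simp add: inverse_partial_fourier_def)
  show "partial_deriv (0, 1) (inverse_partial_fourier r G) =
         inverse_partial_fourier r (\<lambda>z. (2 * pi * \<i>) * complex_of_real (snd z) * G z)"
    unfolding * pK by (simp add: inverse_partial_fourier_def p0 scaleR_conv_of_real mult_ac)
qed

lemma continuous_on_slice:
  assumes "smooth F"
  shows "continuous_on S (\<lambda>t. F (x, t))"
  by (rule continuous_on_compose2[OF smooth_continuous[OF assms, of UNIV]]) (auto intro!: continuous_intros)

text \<open>Multiplication by the frequency becomes a derivative of \<open>G\<close>; the boundary terms vanish with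
  \<open>G\<close>.\<close>

lemma inverse_partial_fourier_by_parts:
  assumes G: "smooth G" and zero: "\<And>z. norm z \<ge> r \<Longrightarrow> G z = 0" and r: "r \<ge> 0"
  shows "complex_of_real (snd z) * inverse_partial_fourier r G z =
         \<i> / (2 * pi) * inverse_partial_fourier r (partial_deriv (0, 1) G) z"
proof -
  obtain x \<omega> where z: "z = (x, \<omega>)" by (cases z)
  let ?e = "\<lambda>t. cis (2 * pi * \<omega> * t)"
  let ?D = "\<lambda>t. partial_deriv (0, 1) G (x, t)"
  have lin: "linear (\<lambda>v. partial_deriv v G y)" for y
    using has_derivative_linear[OF smooth_has_derivative[OF G]] .
  have d1: "((\<lambda>t. (x, t)) has_derivative (\<lambda>h. (0, h))) (at t)" for t :: real
    by (auto intro!: derivative_eq_intros)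
  have d2: "((\<lambda>t. 2 * pi * \<omega> * t) has_derivative (\<lambda>h. 2 * pi * \<omega> * h)) (at t)" for t :: real
    by (auto intro!: derivative_eq_intros)
  have "((\<lambda>t. G (x, t) * ?e t) has_vector_derivative
      (2 * pi * \<i> * \<omega>) * (G (x, t) * ?e t) + ?D t * ?e t) (at t within S)" for t S
  proof -
    have "((\<lambda>t. G (x, t) * ?e t) has_derivative
        (\<lambda>h. G (x, t) * ((2 * pi * \<omega> * h) *\<^sub>R (\<i> * ?e t)) + partial_deriv (0, h) G (x, t) * ?e t)) (at t)"
      by (intro has_derivative_mult has_derivative_cis d2 has_derivative_compose[OF d1 smooth_has_derivative[OF G]])
    moreover define D where "D = ?D t"
    have "partial_deriv (0, h) G (x, t) = complex_of_real h * D" for h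
      using linear_scale[OF lin, of h "(0, 1)"] by (simp add: scaleR_conv_of_real D_def)
    then have "G (x, t) * ((2 * pi * \<omega> * h) *\<^sub>R (\<i> * ?e t)) + partial_deriv (0, h) G (x, t) * ?e t =
        h *\<^sub>R ((2 * pi * \<i> * \<omega>) * (G (x, t) * ?e t) + ?D t * ?e t)" for h
      unfolding D_def[symmetric] by (simp add: scaleR_conv_of_real algebra_simps)
    ultimately have "((\<lambda>t. G (x, t) * ?e t) has_derivative
        (\<lambda>h. h *\<^sub>R ((2 * pi * \<i> * \<omega>) * (G (x, t) * ?e t) + ?D t * ?e t))) (at t)"
      by simp
    then show ?thesis
      unfolding has_vector_derivative_def by (rule has_derivative_at_withinI)
  qed
  then have "((\<lambda>t. (2 * pi * \<i> * \<omega>) * (G (x, t) * ?e t) + ?D t * ?e t) has_integral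
      (G (x, r) * ?e r - G (x, -r) * ?e (-r))) {-r..r}"
    by (intro fundamental_theorem_of_calculus) (use r in auto)
  moreover have "G (x, r) = 0" "G (x, -r) = 0"
    using r norm_snd_le[of r x] norm_snd_le[of "-r" x] by (auto intro!: zero)
  ultimately have total: "integral {-r..r} (\<lambda>t. (2 * pi * \<i> * \<omega>) * (G (x, t) * ?e t) + ?D t * ?e t) = 0"
    by (simp add: integral_unique)
  have i1: "(\<lambda>t. G (x, t) * ?e t) integrable_on {-r..r}"
    by (intro integrable_continuous_real continuous_intros continuous_on_slice G)
  have i2: "(\<lambda>t. ?D t * ?e t) integrable_on {-r..r}"
    by (intro integrable_continuous_real continuous_intros continuous_on_slice smooth_partial_deriv G)
      (simp add: Basis_prod_def)
  have "integral {-r..r} (\<lambda>t. (2 * pi * \<i> * \<omega>) * (G (x, t) * ?e t) + ?D t * ?e t) =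
      integral {-r..r} (\<lambda>t. (2 * pi * \<i> * \<omega>) * (G (x, t) * ?e t)) + integral {-r..r} (\<lambda>t. ?D t * ?e t)"
    by (intro Henstock_Kurzweil_Integration.integral_add integrable_on_mult_right i1 i2)
  also have "integral {-r..r} (\<lambda>t. (2 * pi * \<i> * \<omega>) * (G (x, t) * ?e t)) =
      (2 * pi * \<i> * \<omega>) * integral {-r..r} (\<lambda>t. G (x, t) * ?e t)"
    by (rule Henstock_Kurzweil_Integration.integral_mult_right)
  finally have "(2 * pi * \<i> * \<omega>) * inverse_partial_fourier r G z + inverse_partial_fourier r (partial_deriv (0, 1) G) z = 0"
    unfolding total by (simp add: z inverse_partial_fourier_def)
  then have "inverse_partial_fourier r (partial_deriv (0, 1) G) z = - ((2 * pi * \<i> * \<omega>) * inverse_partial_fourier r G z)"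
    by (simp only: eq_neg_iff_add_eq_0 add.commute)
  then show ?thesis by (simp add: z)
qed


text \<open>The functions vanish on the open set \<open>norm z > r\<close>, hence so do their derivatives.  The
  integrals below extend to \<open>r + 1\<close>, where such functions are certain to vanish.\<close>

definition supported_in_cball :: "real \<Rightarrow> (real \<times> real \<Rightarrow> complex) \<Rightarrow> bool" where
  "supported_in_cball r G \<longleftrightarrow> smooth G \<and> (\<forall>z. norm z > r \<longrightarrow> G z = 0)"

lemma supported_in_cball_partial_deriv:
  assumes "supported_in_cball r G" "v \<in> Basis"
  shows "supported_in_cball r (partial_deriv v G)"
  unfolding supported_in_cball_def
proof (intro conjI allI impI)
  show "smooth (partial_deriv v G)" using assms by (auto simp: supported_in_cball_def intro: smooth_partial_deriv)
  fix z :: "real \<times> real" assume "norm z > r"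
  moreover have "open {z::real \<times> real. norm z > r}" by (intro open_Collect_less continuous_intros)
  ultimately show "partial_deriv v G z = 0"
    using assms by (intro partial_deriv_zero_on_open[of "{z. norm z > r}"]) (auto simp: supported_in_cball_def)
qed

lemma inverse_partial_fourier_eq_0:
  "supported_in_cball r G \<Longrightarrow> \<bar>fst z\<bar> > r \<Longrightarrow> inverse_partial_fourier s G z = 0"
proof -
  assume G: "supported_in_cball r G" and z: "\<bar>fst z\<bar> > r"
  have "G (fst z, t) = 0" for t
  proof -
    have "r < norm (fst z, t)" using z norm_fst_le[of "fst z" t] by simp
    then show ?thesis using G by (simp add: supported_in_cball_def)
  qed
  then show ?thesis by (simp add: inverse_partial_fourier_def)
qed

text \<open>In \<open>x\<close> the transform has bounded support, and each power of the frequency is absorbed by an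
  integration by parts.\<close>

lemma inverse_partial_fourier_decay:
  assumes "supported_in_cball r G" and r: "r \<ge> 0"
  shows "\<exists>C. \<forall>z. (1 + norm z) ^ N * norm (inverse_partial_fourier (r + 1) G z) \<le> C"
  using assms(1)
proof (induction N arbitrary: G)
  case 0
  have "test_function G" using 0 by (rule_tac test_functionI[of _ "r + 1"]) (auto simp: supported_in_cball_def)
  then obtain B where B: "B \<ge> 0" "\<And>z. (1 + norm z) ^ 0 * norm (G z) \<le> B"
    using schwartz_bound[OF test_function_schwartz, of G 0] by blast
  have sG: "smooth G" using 0 by (simp add: supported_in_cball_def)
  have "norm (inverse_partial_fourier (r + 1) G z) \<le> B * ((r + 1) - (- (r + 1)))" for z
    unfolding inverse_partial_fourier_def
  proof (rule integral_bound)
    show "continuous_on {- (r + 1)..r + 1} (\<lambda>t. G (fst z, t) * cis (2 * pi * snd z * t))"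
      by (intro continuous_intros continuous_on_slice sG)
    show "norm (G (fst z, t) * cis (2 * pi * snd z * t)) \<le> B" for t
      using B(2)[of "(fst z, t)"] by (simp add: norm_mult)
  qed (use r in simp)
  then show ?case by auto
next
  case (Suc N)
  let ?F = "inverse_partial_fourier (r + 1)"
  have sG: "smooth G" and zG: "\<And>z. norm z > r \<Longrightarrow> G z = 0"
    using Suc.prems by (auto simp: supported_in_cball_def)
  obtain C1 where C1: "\<And>z. (1 + norm z) ^ N * norm (?F G z) \<le> C1"
    using Suc.IH[OF Suc.prems] by blast
  have "supported_in_cball r (partial_deriv (0, 1) G)"
    by (intro supported_in_cball_partial_deriv Suc.prems) (simp add: Basis_prod_def)
  then obtain C2 where C2: "\<And>z. (1 + norm z) ^ N * norm (?F (partial_deriv (0, 1) G) z) \<le> C2"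
    using Suc.IH by blast
  have "(1 + norm z) ^ Suc N * norm (?F G z) \<le> (1 + r) * C1 + C2 / (2 * pi)" for z
  proof -
    let ?w = "(1 + norm z) ^ N"
    have w: "?w \<ge> 0" by simp
    have "complex_of_real (snd z) * ?F G z = \<i> / (2 * pi) * ?F (partial_deriv (0, 1) G) z"
      by (rule inverse_partial_fourier_by_parts[OF sG]) (use zG r in auto)
    then have "norm (complex_of_real (snd z) * ?F G z) = norm (\<i> / (2 * pi) * ?F (partial_deriv (0, 1) G) z)"
      by simp
    then have parts: "\<bar>snd z\<bar> * norm (?F G z) = norm (?F (partial_deriv (0, 1) G) z) / (2 * pi)"
      by (simp add: norm_mult norm_divide)
    have "(1 + norm z) * norm (?F G z) \<le> (1 + r) * norm (?F G z) + \<bar>snd z\<bar> * norm (?F G z)"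
    proof (cases "\<bar>fst z\<bar> > r")
      case True
      then show ?thesis using inverse_partial_fourier_eq_0[OF Suc.prems] by simp
    next
      case False
      then have "1 + norm z \<le> 1 + r + \<bar>snd z\<bar>"
        using norm_Pair_le[of "fst z" "snd z"] by simp
      from mult_right_mono[OF this, of "norm (?F G z)"] show ?thesis
        by (simp add: distrib_right)
    qed
    then have "?w * ((1 + norm z) * norm (?F G z)) \<le>
        ?w * ((1 + r) * norm (?F G z) + norm (?F (partial_deriv (0, 1) G) z) / (2 * pi))"
      unfolding parts by (intro mult_left_mono w)
    also have "\<dots> = (1 + r) * (?w * norm (?F G z)) + (?w * norm (?F (partial_deriv (0, 1) G) z)) / (2 * pi)"
      by (simp add: algebra_simps)
    also have "\<dots> \<le> (1 + r) * C1 + C2 / (2 * pi)"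
      by (intro add_mono mult_left_mono divide_right_mono C1 C2) (use r in auto)
    finally show ?thesis by (simp add: mult_ac)
  qed
  then show ?case by blast
qed

lemma schwartz_inverse_partial_fourier:
  assumes "supported_in_cball r G" and r: "r \<ge> 0"
  shows "schwartz (inverse_partial_fourier (r + 1) G)"
proof (rule schwartz_coinduct[where P = "\<lambda>f. \<exists>G. supported_in_cball r G \<and> f = inverse_partial_fourier (r + 1) G"])
  fix f :: "real \<times> real \<Rightarrow> complex" and v :: "real \<times> real"
  assume "\<exists>G. supported_in_cball r G \<and> f = inverse_partial_fourier (r + 1) G"
  then obtain G where G: "supported_in_cball r G" "f = inverse_partial_fourier (r + 1) G" by blast
  then have sG: "smooth G" by (simp add: supported_in_cball_def)
  show "f differentiable (at x)" for x
    unfolding G(2) by (intro smooth_differentiable smooth_inverse_partial_fourier sG)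
  show "\<exists>C. \<forall>x. (1 + norm x) ^ N * norm (f x) \<le> C" for N
    unfolding G(2) by (rule inverse_partial_fourier_decay[OF G(1) r])
  assume "v \<in> Basis"
  then consider "v = (1, 0)" | "v = (0, 1)" by (auto simp: Basis_prod_def)
  then show "\<exists>G. supported_in_cball r G \<and> partial_deriv v f = inverse_partial_fourier (r + 1) G"
  proof cases
    case 1
    moreover have "supported_in_cball r (partial_deriv (1, 0) G)"
      by (intro supported_in_cball_partial_deriv G) (simp add: Basis_prod_def)
    ultimately show ?thesis
      unfolding G(2) using partial_deriv_inverse_partial_fourier(1)[OF sG] by blast
  next
    case 2
    moreover have "supported_in_cball r (\<lambda>z. (2 * pi * \<i>) * complex_of_real (snd z) * G z)"
      using G(1) unfolding supported_in_cball_def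
      by (intro conjI smooth_mult smooth_const smooth_coord(3)) auto
    ultimately show ?thesis
      unfolding G(2) using partial_deriv_inverse_partial_fourier(2)[OF sG] by blast
  qed
qed (use assms in blast)

lemma integrable_square_decay:
  fixes f :: "real \<Rightarrow> complex"
  assumes "continuous_on UNIV f" and "\<And>x. (1 + \<bar>x\<bar>) ^ 2 * norm (f x) \<le> C"
  shows "integrable lborel f"
proof (rule Bochner_Integration.integrable_bound)
  show "integrable lborel (\<lambda>x. C * inverse (1 + x\<^sup>2))"
    using integrable_inverse_1_plus_square by (simp add: set_integrable_def)
  show "f \<in> borel_measurable lborel"
    using borel_measurable_continuous_onI[OF assms(1)] by simp
  show "AE x in lborel. norm (f x) \<le> norm (C * inverse (1 + x\<^sup>2))"
  proof (rule AE_I2)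
    fix x :: real
    have "(1 + x\<^sup>2) * norm (f x) \<le> (1 + \<bar>x\<bar>) ^ 2 * norm (f x)"
      by (intro mult_right_mono) (auto simp: power2_eq_square algebra_simps)
    also note assms(2)[of x]
    finally have "norm (f x) \<le> C * inverse (1 + x\<^sup>2)"
      by (simp add: field_simps add_pos_nonneg)
    then show "norm (f x) \<le> norm (C * inverse (1 + x\<^sup>2))" by simp
  qed
qed

lemma partial_fourier_inverse_partial_fourier:
  assumes G: "supported_in_cball r G" and r: "r \<ge> 0"
  shows "partial_fourier (inverse_partial_fourier (r + 1) G) = G"
proof
  fix z :: "real \<times> real"
  obtain x t where z: "z = (x, t)" by (cases z)
  define h where "h = (\<lambda>s. G (x, s))"
  define H where "H = (\<lambda>\<omega>. LINT s|lborel. h s * cis (2 * pi * \<omega> * s))"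
  have sG: "smooth G" using G by (simp add: supported_in_cball_def)
  have cont: "continuous_on UNIV h" unfolding h_def by (rule continuous_on_slice[OF sG])
  have h0: "h s = 0" if "s \<notin> {-(r+1)..r+1}" for s
  proof -
    have "r < norm (x, s)" using that norm_snd_le[of s x] by auto
    then show ?thesis using G by (simp add: h_def supported_in_cball_def)
  qed
  have H: "inverse_partial_fourier (r + 1) G (x, \<omega>) = H \<omega>" for \<omega>
    unfolding inverse_partial_fourier_def H_def fst_conv snd_conv h_def
  proof (rule compact_support_integrable)
    show "continuous_on UNIV (\<lambda>s. G (x, s) * cis (2 * pi * \<omega> * s))"
      by (intro continuous_intros continuous_on_slice sG)
  qed (use h0 in \<open>auto simp: h_def\<close>)
  obtain C where C: "\<And>z. (1 + norm z) ^ 2 * norm (inverse_partial_fourier (r + 1) G z) \<le> C"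
    using inverse_partial_fourier_decay[OF G r, of 2] by blast
  have "integrable lborel H"
  proof (rule integrable_square_decay)
    show "continuous_on UNIV H"
      unfolding H[symmetric, abs_def]
      by (intro continuous_on_slice smooth_inverse_partial_fourier sG)
    show "(1 + \<bar>\<omega>\<bar>) ^ 2 * norm (H \<omega>) \<le> C" for \<omega>
    proof -
      have "(1 + \<bar>\<omega>\<bar>) ^ 2 * norm (H \<omega>) \<le> (1 + norm (x, \<omega>)) ^ 2 * norm (H \<omega>)"
        using norm_snd_le[of \<omega> x] by (intro mult_right_mono power_mono) auto
      also have "\<dots> \<le> C" using C[of "(x, \<omega>)"] by (simp add: H)
      finally show ?thesis .
    qed
  qed
  then have "(LINT \<omega>|lborel. H \<omega> * cis (- 2 * pi * \<omega> * t)) = h t"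
    unfolding H_def using fourier_inversion_compact_support[OF cont, of "-(r+1)" "r+1" t] h0 by blast
  moreover have "partial_fourier (inverse_partial_fourier (r + 1) G) z = (LINT \<omega>|lborel. H \<omega> * cis (- 2 * pi * \<omega> * t))"
    by (simp add: z partial_fourier_def H cis_conv_exp mult_ac)
  ultimately show "partial_fourier (inverse_partial_fourier (r + 1) G) z = G z"
    by (simp add: z h_def)
qed

section \<open>Functionals that are locally multiples of a point mass\<close>

text \<open>Partitions of unity and division by linear factors stay within the test functions; linearity
  there is what the local arguments use.\<close>

definition test_linear :: "real functional \<Rightarrow> bool" where
  "test_linear u \<longleftrightarrow>
     (\<forall>f g. test_function f \<longrightarrow> test_function g \<longrightarrow> u (\<lambda>x. f x + g x) = u f + u g) \<and>
     (\<forall>k f. test_function f \<longrightarrow> u (\<lambda>x. k * f x) = k * u f)"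

lemma test_linear_add:
  "test_linear u \<Longrightarrow> test_function f \<Longrightarrow> test_function g \<Longrightarrow> u (\<lambda>x. f x + g x) = u f + u g"
  by (simp add: test_linear_def)

lemma test_linear_cmult: "test_linear u \<Longrightarrow> test_function f \<Longrightarrow> u (\<lambda>x. k * f x) = k * u f"
  by (simp add: test_linear_def)

lemma test_function_cmult: "test_function f \<Longrightarrow> test_function (\<lambda>x. k * f x)"
  by (intro test_function_mult smooth_const)

lemma test_linear_0: "test_linear u \<Longrightarrow> u (\<lambda>x. 0) = 0"
  using test_linear_cmult[of u "\<lambda>x. 0" 0] by simp

lemma test_linear_sum:
  assumes "test_linear u" and "finite I" and "\<And>i. i \<in> I \<Longrightarrow> test_function (f i)"
  shows "u (\<lambda>x. \<Sum>i\<in>I. f i x) = (\<Sum>i\<in>I. u (f i))"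
  using assms(2,3)
proof (induction rule: finite_induct)
  case (insert i I)
  then have "u (\<lambda>x. f i x + (\<Sum>i\<in>I. f i x)) = u (f i) + u (\<lambda>x. \<Sum>i\<in>I. f i x)"
    by (intro test_linear_add assms(1) test_function_sum) auto
  with insert show ?case by simp
qed (simp add: test_linear_0 assms(1))

lemma test_linear_diff:
  assumes "test_linear u" "test_function f" "test_function g"
  shows "u (\<lambda>x. f x - g x) = u f - u g"
  using test_linear_add[OF assms(1,2) test_function_cmult[OF assms(3), of "-1"]]
    test_linear_cmult[OF assms(1,3), of "-1"] by simp

lemma test_function_diff: "test_function f \<Longrightarrow> test_function g \<Longrightarrow> test_function (\<lambda>x. f x - g x)"
  using test_function_add[OF _ test_function_cmult[of g "-1"], of f] by simp

lemma test_function_scaled_bump: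
  assumes "\<epsilon> > 0"
  shows "test_function (\<lambda>x. bump ((x - c) / \<epsilon>))"
proof (rule test_functionI)
  show "smooth (\<lambda>x. bump ((x - c) / \<epsilon>))"
    using smooth_compose_affine[OF smooth_bump, of "1 / \<epsilon>" "- c / \<epsilon>"] by (simp add: diff_divide_distrib)
  show "bump ((x - c) / \<epsilon>) = 0" if "norm x \<ge> \<bar>c\<bar> + \<epsilon>" for x
    using that assms by (intro bump_eq_0) (auto simp: field_simps abs_if split: if_splits)
qed

lemma scaled_bump_eq_0: "\<epsilon> > 0 \<Longrightarrow> \<bar>x - c\<bar> \<ge> \<epsilon> \<Longrightarrow> bump ((x - c) / \<epsilon>) = 0"
  by (intro bump_eq_0) (auto simp: field_simps)

text \<open>A partition of unity at scale \<open>\<epsilon>\<close>: if \<open>u\<close> vanishes on all test functions with support in short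
  intervals, it vanishes.  The condition on \<open>\<phi>\<close> allows zeros of \<open>\<phi>\<close> to be inherited by the pieces.\<close>

lemma test_linear_eq_0_local:
  assumes u: "test_linear u" and \<phi>: "test_function \<phi>" and \<epsilon>: "\<epsilon> > 0"
    and loc: "\<And>\<psi> x0. test_function \<psi> \<Longrightarrow> (\<And>x. \<psi> x \<noteq> 0 \<Longrightarrow> \<bar>x - x0\<bar> < \<epsilon> \<and> \<phi> x \<noteq> 0) \<Longrightarrow> u \<psi> = 0"
  shows "u \<phi> = 0"
proof -
  obtain R where R: "\<And>x. norm x \<ge> R \<Longrightarrow> \<phi> x = 0" using \<phi> by (auto simp: test_function_iff)
  obtain M :: nat where M: "R / \<epsilon> \<le> M" using real_arch_simple by blast
  define \<psi> where "\<psi> = (\<lambda>(j::int) x. bump ((x - \<epsilon> * j) / \<epsilon>) * \<phi> x)"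
  have \<psi>: "test_function (\<psi> j)" for j
    unfolding \<psi>_def by (intro test_function_mult test_function_smooth test_function_scaled_bump \<phi> \<epsilon>)
  have "\<phi> x = (\<Sum>j\<in>{-int M..int M}. \<psi> j x)" for x
  proof (cases "\<bar>x\<bar> < R")
    case True
    then have "\<bar>x / \<epsilon>\<bar> \<le> M" using M \<epsilon> by (simp add: field_simps)
    from sum_bump[OF this] have "(\<Sum>j\<in>{-int M..int M}. bump (x / \<epsilon> - j)) = 1" .
    moreover have "x / \<epsilon> - real_of_int j = (x - \<epsilon> * j) / \<epsilon>" for j using \<epsilon> by (simp add: field_simps)
    ultimately show ?thesis by (simp add: \<psi>_def flip: sum_distrib_right)
  next
    case False
    then show ?thesis using R[of x] by (simp add: \<psi>_def)
  qed
  then have "\<phi> = (\<lambda>x. \<Sum>j\<in>{-int M..int M}. \<psi> j x)" by blast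
  then have "u \<phi> = (\<Sum>j\<in>{-int M..int M}. u (\<psi> j))"
    using test_linear_sum[OF u, of "{-int M..int M}" \<psi>] \<psi> by simp
  also have "\<dots> = 0"
  proof (intro sum.neutral ballI)
    fix j :: int
    show "u (\<psi> j) = 0"
    proof (rule loc[OF \<psi>])
      fix x assume "\<psi> j x \<noteq> 0"
      then show "\<bar>x - \<epsilon> * j\<bar> < \<epsilon> \<and> \<phi> x \<noteq> 0"
        using scaled_bump_eq_0[OF \<epsilon>, of x "\<epsilon> * j"] by (force simp: \<psi>_def)
    qed
  qed
  finally show ?thesis .
qed

text \<open>On each interval of radius \<open>\<epsilon>\<close> the functional is a multiple of the point mass at \<open>\<kappa>\<close>.  The
  point \<open>\<kappa>\<close> is allowed to be complex or outside the interval, and then the functional is zero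
  there.\<close>

definition locally_point_mass :: "real \<Rightarrow> real functional \<Rightarrow> bool" where
  "locally_point_mass \<epsilon> u \<longleftrightarrow> (\<forall>x0. \<exists>\<kappa>::complex. \<forall>\<phi>. test_function \<phi> \<longrightarrow>
     (\<forall>x. \<phi> x \<noteq> 0 \<longrightarrow> \<bar>x - x0\<bar> < \<epsilon> \<and> complex_of_real x \<noteq> \<kappa>) \<longrightarrow> u \<phi> = 0)"

text \<open>Fix \<open>\<psi>1\<close> with small support and \<open>v \<psi>1 \<noteq> 0\<close>.  Solving the relation for \<open>u (x * q)\<close> shows that, for
  \<open>q\<close> supported near \<open>x0\<close>, multiplication by \<open>x\<close> acts as a constant \<open>\<kappa>\<close> under \<open>u\<close>.  A test function
  that vanishes at \<open>\<kappa>\<close> has the form \<open>(x - \<kappa>) * q\<close> and is therefore annihilated.\<close>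

lemma locally_point_mass_if_collinear:
  fixes a b \<delta> :: real and u v :: "real functional"
  assumes u: "test_linear u" and v: "test_linear v" and ab: "a \<noteq> 0" "b \<noteq> 0"
    and A: "\<delta> > 0" "\<And>r s. r \<in> A \<Longrightarrow> s \<in> A \<Longrightarrow> \<bar>r - s\<bar> < \<delta> \<Longrightarrow> r = s"
    and nz: "test_function \<psi>" "v \<psi> \<noteq> 0"
    and rel: "\<And>(\<phi> :: real \<Rightarrow> complex) (\<psi> :: real \<Rightarrow> complex) r. test_function \<phi> \<Longrightarrow> test_function \<psi> \<Longrightarrow>
      (\<And>x y. \<phi> x \<noteq> 0 \<Longrightarrow> \<psi> y \<noteq> 0 \<Longrightarrow> a * x + b * y \<in> A \<Longrightarrow> a * x + b * y = r) \<Longrightarrow>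
      a * u (\<lambda>x. x * \<phi> x) * v \<psi> + b * u \<phi> * v (\<lambda>y. y * \<psi> y) = r * u \<phi> * v \<psi>"
  shows "\<exists>\<epsilon>>0. locally_point_mass \<epsilon> u"
proof -
  \<comment> \<open>Then \<open>a * x + b * y\<close> varies by less than \<open>\<delta>\<close> as \<open>x\<close> and \<open>y\<close> range over intervals of radius \<open>\<epsilon>\<close>.\<close>
  define \<epsilon> where "\<epsilon> = \<delta> / (2 * (\<bar>a\<bar> + \<bar>b\<bar>))"
  have \<epsilon>: "\<epsilon> > 0" using A ab by (simp add: \<epsilon>_def)
  have \<epsilon>_eq: "2 * \<bar>a\<bar> * \<epsilon> + 2 * \<bar>b\<bar> * \<epsilon> = \<delta>" using ab by (simp add: \<epsilon>_def field_simps add_nonneg_eq_0_iff)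
  obtain \<psi>1 y0 where \<psi>1: "test_function \<psi>1" "v \<psi>1 \<noteq> 0" "\<And>y. \<psi>1 y \<noteq> 0 \<Longrightarrow> \<bar>y - y0\<bar> < \<epsilon>"
    using test_linear_eq_0_local[OF v nz(1) \<epsilon>] nz(2) by metis
  have "locally_point_mass \<epsilon> u"
    unfolding locally_point_mass_def
  proof
    fix x0
    \<comment> \<open>At most one value of \<open>A\<close> is attained near \<open>(x0, y0)\<close>; the bound for \<open>x\<close> is not strict because
      the quotient \<open>q\<close> below may be nonzero at the ends of the interval.\<close>
    define near where "near = (\<lambda>r. r \<in> A \<and> (\<exists>x y. \<bar>x - x0\<bar> \<le> \<epsilon> \<and> \<bar>y - y0\<bar> < \<epsilon> \<and> r = a * x + b * y))"
    have unique: "r = s" if "near r" "near s" for r s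
    proof -
      obtain x y x' y' where r: "\<bar>x - x0\<bar> \<le> \<epsilon>" "\<bar>y - y0\<bar> < \<epsilon>" "r = a * x + b * y" "r \<in> A"
        and s: "\<bar>x' - x0\<bar> \<le> \<epsilon>" "\<bar>y' - y0\<bar> < \<epsilon>" "s = a * x' + b * y'" "s \<in> A"
        using \<open>near r\<close> \<open>near s\<close> unfolding near_def by blast
      have "\<bar>r - s\<bar> = \<bar>a * (x - x') + b * (y - y')\<bar>" by (simp add: r s algebra_simps)
      also have "\<dots> \<le> \<bar>a\<bar> * \<bar>x - x'\<bar> + \<bar>b\<bar> * \<bar>y - y'\<bar>"
        by (metis abs_mult abs_triangle_ineq)
      also have "\<dots> < \<bar>a\<bar> * (2 * \<epsilon>) + \<bar>b\<bar> * (2 * \<epsilon>)"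
        by (rule add_le_less_mono; rule mult_left_mono mult_strict_left_mono) (use r s ab in auto)
      also have "\<dots> = \<delta>" using \<epsilon>_eq by (simp add: algebra_simps)
      finally show ?thesis using A(2) r(4) s(4) by blast
    qed
    define r where "r = (SOME r. near r)"
    have r: "s = r" if "near s" for s
      using unique[OF that] someI[of near s] that by (metis r_def)
    define \<kappa> where "\<kappa> = (r - b * v (\<lambda>y. y * \<psi>1 y) / v \<psi>1) / a"
    show "\<exists>\<kappa>::complex. \<forall>\<phi>. test_function \<phi> \<longrightarrow>
      (\<forall>x. \<phi> x \<noteq> 0 \<longrightarrow> \<bar>x - x0\<bar> < \<epsilon> \<and> complex_of_real x \<noteq> \<kappa>) \<longrightarrow> u \<phi> = 0"
    proof (intro exI[of _ \<kappa>] allI impI)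
      fix \<phi> assume \<phi>: "test_function \<phi>"
        and supp: "\<forall>x. \<phi> x \<noteq> 0 \<longrightarrow> \<bar>x - x0\<bar> < \<epsilon> \<and> complex_of_real x \<noteq> \<kappa>"
      obtain q where q: "test_function q" "\<And>x. \<phi> x = (complex_of_real x - \<kappa>) * q x"
        "{x. q x \<noteq> 0} \<subseteq> closure {x. \<phi> x \<noteq> 0}"
        using test_function_divide[OF \<phi>, of \<kappa>] supp by blast
      have "closure {x. \<phi> x \<noteq> 0} \<subseteq> {x. \<bar>x - x0\<bar> \<le> \<epsilon>}"
        by (intro closure_minimal closed_Collect_le continuous_intros) (use supp in force)
      with q(3) have near_x0: "\<bar>x - x0\<bar> \<le> \<epsilon>" if "q x \<noteq> 0" for x using that by blast
      have "a * u (\<lambda>x. x * q x) * v \<psi>1 + b * u q * v (\<lambda>y. y * \<psi>1 y) = r * u q * v \<psi>1"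
      proof (rule rel[OF q(1) \<psi>1(1)])
        show "a * x + b * y = r" if "q x \<noteq> 0" "\<psi>1 y \<noteq> 0" "a * x + b * y \<in> A" for x y
          using that near_x0 \<psi>1(3) by (intro r) (auto simp: near_def)
      qed
      then have eig: "u (\<lambda>x. x * q x) = \<kappa> * u q"
        using ab \<psi>1(2) by (simp add: \<kappa>_def field_simps)
      have xq: "test_function (\<lambda>x. x * q x)" by (intro test_function_mult smooth_coord q)
      have "\<phi> = (\<lambda>x. x * q x - \<kappa> * q x)" by (simp add: fun_eq_iff q(2) left_diff_distrib)
      then have "u \<phi> = u (\<lambda>x. x * q x) - \<kappa> * u q"
        using test_linear_diff[OF u xq test_function_cmult[OF q(1)], of \<kappa>] test_linear_cmult[OF u q(1)] by simp
      then show "u \<phi> = 0" by (simp add: eig)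
    qed
  qed
  with \<epsilon> show ?thesis by blast
qed

text \<open>The sum ranges over the points of \<open>S\<close> in the support of \<open>\<phi>\<close>, of which there are finitely many.\<close>

definition discrete_sum :: "real set \<Rightarrow> (real \<Rightarrow> complex) \<Rightarrow> real functional \<Rightarrow> bool" where
  "discrete_sum S w u \<longleftrightarrow> uniform_discrete S \<and>
     (\<forall>\<phi>. test_function \<phi> \<longrightarrow> u \<phi> = (\<Sum>x | x \<in> S \<and> \<phi> x \<noteq> 0. w x * \<phi> x))"

lemma finite_uniform_discrete_Int_support:
  fixes S :: "real set"
  assumes "uniform_discrete S" "test_function \<phi>"
  shows "finite {x. x \<in> S \<and> \<phi> x \<noteq> 0}"
proof -
  have "uniform_discrete {x. x \<in> S \<and> \<phi> x \<noteq> 0}"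
    by (rule uniform_discrete_subset[OF assms(1)]) auto
  moreover have "bounded {x. x \<in> S \<and> \<phi> x \<noteq> 0}"
  proof -
    have "bounded (closure {x. \<phi> x \<noteq> 0})" using assms(2) by (auto simp: test_function_def compact_imp_bounded)
    then show ?thesis by (rule bounded_subset) (use closure_subset[of "{x. \<phi> x \<noteq> 0}"] in auto)
  qed
  ultimately show ?thesis using uniform_discrete_finite_iff by blast
qed

text \<open>Each support point of \<open>u\<close> within distance \<open>\<epsilon>\<close> of \<open>x0\<close> must be the point \<open>\<kappa>\<close> belonging to \<open>x0\<close>;
  so two support points have distance at least \<open>\<epsilon>\<close>.  A test function vanishing on the support is
  annihilated, since this can be checked on the pieces of a partition of unity.  Subtracting from \<open>\<phi>\<close>
  bumps centred at the support points, with heights \<open>\<phi> c\<close>, gives the sum; its weights are the values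
  of \<open>u\<close> on the bumps.\<close>

lemma locally_point_mass_discrete_sum:
  assumes u: "test_linear u" and \<epsilon>: "\<epsilon> > 0" and loc: "locally_point_mass \<epsilon> u"
  shows "\<exists>S w. discrete_sum S w u"
proof -
  define S where "S = distribution_support u"
  obtain \<kappa> :: "real \<Rightarrow> complex" where \<kappa>: "\<And>x0 \<phi>. test_function \<phi> \<Longrightarrow>
     (\<And>x. \<phi> x \<noteq> 0 \<Longrightarrow> \<bar>x - x0\<bar> < \<epsilon> \<and> complex_of_real x \<noteq> \<kappa> x0) \<Longrightarrow> u \<phi> = 0"
    using loc unfolding locally_point_mass_def by metis
  have S_\<kappa>: "complex_of_real c = \<kappa> x0" if c: "c \<in> S" "\<bar>c - x0\<bar> < \<epsilon>" for c x0
  proof (rule ccontr)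
    assume "complex_of_real c \<noteq> \<kappa> x0"
    define U where "U = {x. \<bar>x - x0\<bar> < \<epsilon>} \<inter> {x. complex_of_real x \<noteq> \<kappa> x0}"
    have "open U" unfolding U_def
      by (intro open_Int open_Collect_less open_Collect_neq continuous_intros)
    moreover have "c \<in> U" using c \<open>complex_of_real c \<noteq> \<kappa> x0\<close> by (simp add: U_def)
    ultimately obtain f where f: "test_function f" "closure {y. f y \<noteq> 0} \<subseteq> U" "u f \<noteq> 0"
      using c(1) unfolding S_def distribution_support_def by blast
    have "u f = 0"
      by (rule \<kappa>[OF f(1), of x0]) (use f(2) closure_subset[of "{y. f y \<noteq> 0}"] in \<open>auto simp: U_def\<close>)
    with f show False by blast
  qed
  have sep: "c = c'" if c: "c \<in> S" "c' \<in> S" "\<bar>c - c'\<bar> < \<epsilon>" for c c'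
  proof -
    have "\<bar>c - (c + c') / 2\<bar> < \<epsilon>" "\<bar>c' - (c + c') / 2\<bar> < \<epsilon>" using c(3) \<epsilon> by (auto simp: abs_if field_simps split: if_splits)
    from S_\<kappa>[OF c(1) this(1)] S_\<kappa>[OF c(2) this(2)] show ?thesis by (metis of_real_eq_iff)
  qed
  then have S: "uniform_discrete S"
    unfolding uniform_discrete_def dist_real_def using \<epsilon> by blast
  have vanish: "u \<phi> = 0" if \<phi>: "test_function \<phi>" "\<And>x. x \<in> S \<Longrightarrow> \<phi> x = 0" for \<phi>
  proof (rule test_linear_eq_0_local[OF u \<phi>(1) \<epsilon>])
    fix \<psi> x0 assume \<psi>: "test_function \<psi>" "\<And>x. \<psi> x \<noteq> 0 \<Longrightarrow> \<bar>x - x0\<bar> < \<epsilon> \<and> \<phi> x \<noteq> 0"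
    show "u \<psi> = 0"
    proof (cases "\<exists>k. complex_of_real k = \<kappa> x0 \<and> \<psi> k \<noteq> 0")
      case False
      then show ?thesis using \<psi> by (intro \<kappa>[OF \<psi>(1), of x0]) auto
    next
      case True
      then obtain k where k: "complex_of_real k = \<kappa> x0" "\<psi> k \<noteq> 0" by blast
      with \<psi>(2) \<phi>(2) have k': "\<bar>k - x0\<bar> < \<epsilon>" "k \<notin> S" by blast+
      then obtain U where U: "open U" "k \<in> U"
        "\<And>f. test_function f \<Longrightarrow> closure {y. f y \<noteq> 0} \<subseteq> U \<Longrightarrow> u f = 0"
        unfolding S_def distribution_support_def by blast
      have "open (U \<inter> {x. \<bar>x - x0\<bar> < \<epsilon>})"
        by (intro open_Int U open_Collect_less continuous_intros)
      moreover have "k \<in> U \<inter> {x. \<bar>x - x0\<bar> < \<epsilon>}" using U k' by simp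
      ultimately obtain \<rho> where \<rho>: "\<rho> > 0" "cball k \<rho> \<subseteq> U \<inter> {x. \<bar>x - x0\<bar> < \<epsilon>}"
        using open_contains_cball by blast
      \<comment> \<open>As \<open>k\<close> is not a support point, a narrow bump at \<open>k\<close> is annihilated and can be used to
        change the value of \<open>\<psi>\<close> at \<open>k\<close> to \<open>0\<close>.\<close>
      define \<theta> where "\<theta> = (\<lambda>x. bump ((x - k) / \<rho>))"
      have \<theta>: "test_function \<theta>" unfolding \<theta>_def by (rule test_function_scaled_bump[OF \<rho>(1)])
      have \<theta>_supp: "{y. \<theta> y \<noteq> 0} \<subseteq> cball k \<rho>"
        using scaled_bump_eq_0[OF \<rho>(1), of _ k] by (force simp: \<theta>_def dist_real_def)
      then have "closure {y. \<theta> y \<noteq> 0} \<subseteq> cball k \<rho>" by (intro closure_minimal) auto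
      then have "u \<theta> = 0" using U(3)[OF \<theta>] \<rho>(2) by blast
      have "u (\<lambda>x. \<psi> x - \<psi> k * \<theta> x) = 0"
      proof (rule \<kappa>[of _ x0])
        show "test_function (\<lambda>x. \<psi> x - \<psi> k * \<theta> x)"
          by (intro test_function_diff test_function_cmult \<psi> \<theta>)
        fix x assume x: "\<psi> x - \<psi> k * \<theta> x \<noteq> 0"
        then have "\<psi> x \<noteq> 0 \<or> \<theta> x \<noteq> 0" by auto
        then have "\<bar>x - x0\<bar> < \<epsilon>" using \<psi>(2) \<theta>_supp \<rho>(2) by blast
        moreover have "x \<noteq> k" using x by (auto simp: \<theta>_def)
        ultimately show "\<bar>x - x0\<bar> < \<epsilon> \<and> complex_of_real x \<noteq> \<kappa> x0" using k(1) by (metis of_real_eq_iff)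
      qed
      moreover have "u (\<lambda>x. \<psi> x - \<psi> k * \<theta> x) = u \<psi> - \<psi> k * u \<theta>"
        using test_linear_diff[OF u \<psi>(1) test_function_cmult[OF \<theta>]] test_linear_cmult[OF u \<theta>] by simp
      ultimately show ?thesis using \<open>u \<theta> = 0\<close> by simp
    qed
  qed
  define \<beta> where "\<beta> = (\<lambda>c x. bump ((x - c) / \<epsilon>))"
  have \<beta>: "test_function (\<beta> c)" for c unfolding \<beta>_def by (rule test_function_scaled_bump[OF \<epsilon>])
  have "u \<phi> = (\<Sum>c | c \<in> S \<and> \<phi> c \<noteq> 0. u (\<beta> c) * \<phi> c)" if \<phi>: "test_function \<phi>" for \<phi>
  proof -
    define F where "F = {c. c \<in> S \<and> \<phi> c \<noteq> 0}"
    have F: "finite F" unfolding F_def by (rule finite_uniform_discrete_Int_support[OF S \<phi>])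
    let ?g = "\<lambda>x. \<Sum>c\<in>F. \<phi> c * \<beta> c x"
    have g: "test_function ?g" by (intro test_function_sum F test_function_cmult \<beta>)
    have "u (\<lambda>x. \<phi> x - ?g x) = 0"
    proof (rule vanish)
      fix s assume s: "s \<in> S"
      have "\<beta> c s = (if c = s then 1 else 0)" if "c \<in> F" for c
        using sep[OF s, of c] that scaled_bump_eq_0[OF \<epsilon>, of s c] by (force simp: \<beta>_def F_def)
      then have "?g s = (\<Sum>c\<in>F. if c = s then \<phi> c else 0)" by (intro sum.cong) auto
      also have "\<dots> = \<phi> s" using F s by (auto simp: F_def)
      finally show "\<phi> s - ?g s = 0" by simp
    qed (intro test_function_diff \<phi> g)
    then have "u \<phi> = u ?g" using test_linear_diff[OF u \<phi> g] by simp
    also have "\<dots> = (\<Sum>c\<in>F. u (\<lambda>x. \<phi> c * \<beta> c x))"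
      by (intro test_linear_sum u F test_function_cmult \<beta>)
    also have "\<dots> = (\<Sum>c\<in>F. u (\<beta> c) * \<phi> c)"
      by (intro sum.cong) (simp_all add: test_linear_cmult[OF u \<beta>])
    finally show ?thesis by (simp add: F_def)
  qed
  then have "discrete_sum S (\<lambda>c. u (\<beta> c)) u" using S by (simp add: discrete_sum_def)
  then show ?thesis by blast
qed

section \<open>Uniformly discrete sums of point masses\<close>

lemma discrete_sum_conj:
  assumes "discrete_sum S w u"
  shows "discrete_sum S (\<lambda>x. cnj (w x)) (conj_distribution u)"
  unfolding discrete_sum_def
proof (intro conjI allI impI)
  show "uniform_discrete S" using assms by (simp add: discrete_sum_def)
  fix \<phi> :: "real \<Rightarrow> complex" assume "test_function \<phi>"
  from test_function_cnj[OF this] have "u (\<lambda>x. cnj (\<phi> x)) = (\<Sum>x | x \<in> S \<and> cnj (\<phi> x) \<noteq> 0. w x * cnj (\<phi> x))"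
    using assms by (simp only: discrete_sum_def)
  then show "conj_distribution u \<phi> = (\<Sum>x | x \<in> S \<and> \<phi> x \<noteq> 0. cnj (w x) * \<phi> x)"
    by (simp add: conj_distribution_def cnj_sum)
qed

lemma discrete_sum_support:
  assumes "discrete_sum S w u"
  shows "distribution_support u \<subseteq> S"
proof
  fix x assume x: "x \<in> distribution_support u"
  show "x \<in> S"
  proof (rule ccontr)
    assume "x \<notin> S"
    moreover have "open (- S)"
      using assms uniform_discrete_imp_closed by (auto simp: discrete_sum_def open_Compl)
    ultimately obtain f where f: "test_function f" "closure {y. f y \<noteq> 0} \<subseteq> - S" "u f \<noteq> 0"
      using x unfolding distribution_support_def by blast
    have "{x. x \<in> S \<and> f x \<noteq> 0} = {}" using f(2) closure_subset[of "{y. f y \<noteq> 0}"] by blast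
    then have "u f = 0" using assms f(1) by (simp add: discrete_sum_def)
    with f show False by blast
  qed
qed

text \<open>The density lives on the subsets of \<open>S\<close>; taking the image turns it into a Borel measure on the line.\<close>

definition weighted_points :: "real set \<Rightarrow> (real \<Rightarrow> real) \<Rightarrow> real measure" where
  "weighted_points S p = distr (density (count_space S) (\<lambda>x. ennreal (p x))) borel (\<lambda>x. x)"

lemma sets_weighted_points [simp]: "sets (weighted_points S p) = sets borel"
  by (simp add: weighted_points_def)

lemma measurable_density_count_space [simp]:
  "f \<in> density (count_space S) p \<rightarrow>\<^sub>M M \<longleftrightarrow> f \<in> S \<rightarrow> space M"
  by (simp add: measurable_cong_sets[OF sets_density refl])

lemma emeasure_weighted_points:
  assumes E: "E \<in> sets borel" and fin: "finite (S \<inter> E)" and p: "\<And>x. p x \<ge> 0"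
  shows "emeasure (weighted_points S p) E = ennreal (\<Sum>x\<in>S \<inter> E. p x)"
proof -
  have "emeasure (weighted_points S p) E = emeasure (density (count_space S) (\<lambda>x. ennreal (p x))) (E \<inter> S)"
    unfolding weighted_points_def by (subst emeasure_distr) (use E in \<open>auto simp: measurable_density_count_space\<close>)
  also have "\<dots> = (\<integral>\<^sup>+x. ennreal (p x) * indicator (E \<inter> S) x \<partial>count_space S)"
    by (subst emeasure_density) auto
  also have "\<dots> = (\<Sum>x\<in>S \<inter> E. ennreal (p x) * indicator (E \<inter> S) x)"
    by (rule nn_integral_count_space'[OF fin]) auto
  also have "\<dots> = (\<Sum>x\<in>S \<inter> E. ennreal (p x))" by (intro sum.cong) auto
  also have "\<dots> = ennreal (\<Sum>x\<in>S \<inter> E. p x)" by (rule sum_ennreal) (rule p)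
  finally show ?thesis .
qed

lemma integral_weighted_points:
  fixes f :: "real \<Rightarrow> complex"
  assumes f: "f \<in> borel_measurable borel" and fin: "finite {x. x \<in> S \<and> f x \<noteq> 0}" and p: "\<And>x. p x \<ge> 0"
  shows "integrable (weighted_points S p) f"
    and "(LINT x|weighted_points S p. f x) = (\<Sum>x | x \<in> S \<and> f x \<noteq> 0. p x * f x)"
proof -
  let ?F = "{x. x \<in> S \<and> f x \<noteq> 0}"
  have "(\<integral>\<^sup>+x. ennreal (norm (p x *\<^sub>R f x)) \<partial>count_space S) = (\<Sum>x\<in>?F. ennreal (norm (p x *\<^sub>R f x)))"
    by (rule nn_integral_count_space'[OF fin]) auto
  also have "\<dots> < \<infinity>" by (simp add: sum_ennreal)
  finally have "integrable (count_space S) (\<lambda>x. p x *\<^sub>R f x)"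
    by (auto simp: integrable_iff_bounded)
  then have "integrable (density (count_space S) (\<lambda>x. ennreal (p x))) f"
    by (subst integrable_density) (use p in auto)
  then show "integrable (weighted_points S p) f"
    unfolding weighted_points_def by (subst integrable_distr_eq) (use f in \<open>auto simp: measurable_density_count_space\<close>)
  have "(LINT x|weighted_points S p. f x) = (LINT x|density (count_space S) (\<lambda>x. ennreal (p x)). f x)"
    unfolding weighted_points_def by (subst integral_distr) (use f in \<open>auto simp: measurable_density_count_space\<close>)
  also have "\<dots> = (LINT x|count_space S. p x *\<^sub>R f x)"
    by (subst integral_density) (use p in auto)
  also have "\<dots> = (\<Sum>x | x \<in> S \<and> p x *\<^sub>R f x \<noteq> 0. p x *\<^sub>R f x)"
    by (rule lebesgue_integral_count_space_finite_support) (rule finite_subset[OF _ fin], auto)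
  also have "\<dots> = (\<Sum>x\<in>?F. p x * f x)"
    by (rule sum.mono_neutral_cong_left[OF fin]) (auto simp: scaleR_conv_of_real)
  finally show "(LINT x|weighted_points S p. f x) = (\<Sum>x\<in>?F. p x * f x)" .
qed

text \<open>The measure is \<open>E \<mapsto> (\<Sum>x\<in>S \<inter> E. w x)\<close>; its four positive parts carry the positive and negative
  parts of the real and imaginary parts of the weights.\<close>

lemma discrete_sum_given_by_measure:
  assumes "discrete_sum S w u"
  shows "given_by_measure u"
proof -
  have S: "uniform_discrete S" using assms by (simp add: discrete_sum_def)
  have fin: "finite (S \<inter> E)" if "bounded E" for E
    using that uniform_discrete_finite_iff uniform_discrete_subset[OF S] by (metis bounded_Int inf_le1)
  define m where "m = (\<lambda>E. \<Sum>x\<in>S \<inter> E. w x)"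
  have "locally_finite_complex_measure m"
    unfolding locally_finite_complex_measure_def
  proof (intro allI impI)
    fix E :: "nat \<Rightarrow> real set"
    assume disj: "disjoint_family E" and bdd: "bounded (\<Union>i. E i)"
    let ?U = "\<Union>i. E i"
    have finU: "finite (S \<inter> ?U)" by (rule fin[OF bdd])
    have "(\<lambda>i. if x \<in> E i then w x else 0) sums w x" if x: "x \<in> S \<inter> ?U" for x
    proof -
      obtain k where k: "x \<in> E k" using x by blast
      have "x \<in> E i \<longleftrightarrow> i = k" for i using disj k by (auto simp: disjoint_family_on_def)
      then show ?thesis using sums_single[of k "\<lambda>i. w x"] by simp
    qed
    then have "(\<lambda>i. \<Sum>x\<in>S \<inter> ?U. if x \<in> E i then w x else 0) sums (\<Sum>x\<in>S \<inter> ?U. w x)"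
      by (intro sums_sum)
    moreover have "(\<Sum>x\<in>S \<inter> ?U. if x \<in> E i then w x else 0) = m (E i)" for i
      unfolding m_def by (rule sum.mono_neutral_cong_right[OF finU]) auto
    ultimately show "(\<lambda>i. m (E i)) sums m ?U" by (simp add: m_def)
  qed
  moreover have "has_complex_measure_integral m f (u f)" if f: "test_function f" for f
  proof -
    define P where "P = (\<lambda>g::complex \<Rightarrow> real. weighted_points S (\<lambda>x. max 0 (g (w x))))"
    have fm: "f \<in> borel_measurable borel"
      by (intro borel_measurable_continuous_onI smooth_continuous test_function_smooth f)
    have finf: "finite {x. x \<in> S \<and> f x \<noteq> 0}" by (rule finite_uniform_discrete_Int_support[OF S f])
    have lf: "locally_finite_borel (P g)" for g
      using emeasure_weighted_points[OF _ fin] by (auto simp: locally_finite_borel_def P_def)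
    have meas: "measure (P g) E = (\<Sum>x\<in>S \<inter> E. max 0 (g (w x)))" if "E \<in> sets borel" "bounded E" for g E
      unfolding P_def measure_def
      by (subst emeasure_weighted_points[OF that(1) fin[OF that(2)]]) (auto intro!: enn2real_ennreal sum_nonneg)
    have int: "integrable (P g) f" "(LINT x|P g. f x) = (\<Sum>x | x \<in> S \<and> f x \<noteq> 0. complex_of_real (max 0 (g (w x))) * f x)" for g
      unfolding P_def using integral_weighted_points[OF fm finf, of "\<lambda>x. max 0 (g (w x))"] by auto
    have pm: "max 0 t - max 0 (- t) = t" for t :: real by auto
    show ?thesis
      unfolding has_complex_measure_integral_def
    proof (intro exI conjI ballI impI)
      fix M assume "M \<in> {P Re, P (\<lambda>z. - Re z), P Im, P (\<lambda>z. - Im z)}"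
      then show "locally_finite_borel M" "integrable M f" using lf int(1) by auto
    next
      fix E :: "real set" assume E: "E \<in> sets borel" "bounded E"
      show "m E = Complex (measure (P Re) E - measure (P (\<lambda>z. - Re z)) E) (measure (P Im) E - measure (P (\<lambda>z. - Im z)) E)"
        by (simp add: meas[OF E] m_def complex_eq_iff pm flip: sum_subtractf)
    next
      have c: "complex_of_real (max 0 (Re z)) * y - complex_of_real (max 0 (- Re z)) * y
          + \<i> * (complex_of_real (max 0 (Im z)) * y - complex_of_real (max 0 (- Im z)) * y) = z * y" for z y
      proof -
        have "complex_of_real (max 0 (Re z)) * y - complex_of_real (max 0 (- Re z)) * y
          + \<i> * (complex_of_real (max 0 (Im z)) * y - complex_of_real (max 0 (- Im z)) * y)
          = (complex_of_real (max 0 (Re z) - max 0 (- Re z)) + \<i> * complex_of_real (max 0 (Im z) - max 0 (- Im z))) * y"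
          by (simp add: algebra_simps)
        then show ?thesis unfolding pm by (simp add: complex_eq[symmetric])
      qed
      have "u f = (\<Sum>x | x \<in> S \<and> f x \<noteq> 0. w x * f x)" using assms f by (simp add: discrete_sum_def)
      then show "u f = (LINT x|P Re. f x) - (LINT x|P (\<lambda>z. - Re z). f x) +
          \<i> * ((LINT x|P Im. f x) - (LINT x|P (\<lambda>z. - Im z). f x))"
        by (simp only: int(2) sum_distrib_left sum_subtractf[symmetric] sum.distrib[symmetric] c)
    qed
  qed
  ultimately show ?thesis unfolding given_by_measure_def by blast
qed

section \<open>The kernel relation\<close>

lemma tempered_test_linear: "tempered_distribution u \<Longrightarrow> test_linear u"
  by (simp add: tempered_distribution_def test_linear_def test_function_schwartz)

lemma conj_distribution_conj [simp]: "conj_distribution (conj_distribution u) = u"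
  by (simp add: conj_distribution_def fun_eq_iff)

lemma test_linear_conj:
  assumes u: "test_linear u"
  shows "test_linear (conj_distribution u)"
  unfolding test_linear_def
proof (intro conjI allI impI)
  show "conj_distribution u (\<lambda>x. f x + g x) = conj_distribution u f + conj_distribution u g"
    if "test_function f" "test_function g" for f g
    using test_linear_add[OF u that[THEN test_function_cnj]] by (simp add: conj_distribution_def)
  show "conj_distribution u (\<lambda>x. k * f x) = k * conj_distribution u f" if "test_function f" for k f
    using test_linear_cmult[OF u test_function_cnj[OF that], of "cnj k"] by (simp add: conj_distribution_def)
qed

lemma det2_nonzero:
  assumes T: "linear T" "inj T"
  shows "det2 T \<noteq> 0"
proof
  assume det: "det2 T = 0"
  obtain p q where pq: "T (1, 0) = (p, q)" by (cases "T (1, 0)")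
  obtain r s where rs: "T (0, 1) = (r, s)" by (cases "T (0, 1)")
  have T_eq: "T (x, y) = (x * p + y * r, x * q + y * s)" for x y
  proof -
    have "T (x, y) = T (x *\<^sub>R (1, 0) + y *\<^sub>R (0, 1))" by simp
    also have "\<dots> = x *\<^sub>R T (1, 0) + y *\<^sub>R T (0, 1)"
      by (simp only: linear_add[OF T(1)] linear_scale[OF T(1)])
    finally show ?thesis by (simp add: pq rs)
  qed
  have ker: "x = 0 \<and> y = 0" if "T (x, y) = (0, 0)" for x y
    using injD[OF T(2), of "(x, y)" "(0, 0)"] that T_eq[of 0 0] by simp
  have "p * s = r * q" using det by (simp add: det2_def pq rs)
  \<comment> \<open>Up to sign, these are the columns of the adjugate matrix; they lie in the kernel.\<close>
  then have "T (s, - q) = (0, 0)" "T (r, - p) = (0, 0)" by (simp_all add: T_eq algebra_simps)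
  from ker[OF this(1)] ker[OF this(2)] have "T (1, 0) = (0, 0)" by (simp add: T_eq)
  from ker[OF this] show False by simp
qed

text \<open>Pair the Wigner transform with the inverse partial Fourier transform of \<open>F \<circ> T\<close>.  The latter
  vanishes at all points with first coordinate in \<open>A\<close>, because it integrates \<open>F \<circ> T\<close> along vertical
  lines only; so the series gives \<open>0\<close>.\<close>

lemma matrix_wigner_test_function:
  fixes T :: "real \<times> real \<Rightarrow> real \<times> real" and F :: "real \<times> real \<Rightarrow> complex"
  assumes T: "linear T" "bij T" and F: "test_function F"
    and W: "\<And>f. schwartz f \<Longrightarrow>
       ((\<lambda>(r, s). coef r s * point_mass (r, s) f) has_sum matrix_wigner T \<mu> \<nu> f) (A \<times> B)"
    and zero: "\<And>x t. x \<in> A \<Longrightarrow> F (T (x, t)) = 0"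
  shows "tensor_distribution \<mu> (conj_distribution \<nu>) F = 0"
proof -
  have inj: "inj T" and surj: "surj T" using T(2) by (auto simp: bij_def)
  define G where "G = (\<lambda>z. F (T z))"
  have sG: "smooth G" unfolding G_def
  proof (rule smooth_compose[OF _ test_function_smooth[OF F]])
    fix i :: "real \<times> real"
    have "linear (\<lambda>x. T x \<bullet> i)"
      using linear_compose[OF T(1) bounded_linear.linear[OF bounded_linear_inner_left], of i] by (simp add: o_def)
    then show "smooth (\<lambda>x. complex_of_real (T x \<bullet> i))" by (rule smooth_linear)
  qed
  obtain c where c: "c > 0" "\<And>z. c * norm z \<le> norm (T z)"
    by (rule linear_inj_bounded_below_pos[OF T(1) inj]) blast
  obtain R where R: "R > 0" "\<And>z. norm z \<ge> R \<Longrightarrow> F z = 0" by (rule test_functionE[OF F]) blast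
  define r where "r = R / c"
  have r: "r \<ge> 0" using R c by (simp add: r_def)
  have G: "supported_in_cball r G"
    unfolding supported_in_cball_def
  proof (intro conjI sG allI impI)
    fix z :: "real \<times> real" assume "norm z > r"
    then have "R < c * norm z" using c(1) by (simp add: r_def field_simps)
    also note c(2)[of z]
    finally have "R < norm (T z)" .
    then show "G z = 0" using R(2) by (simp add: G_def)
  qed
  define f where "f = inverse_partial_fourier (r + 1) G"
  have f: "schwartz f" unfolding f_def by (rule schwartz_inverse_partial_fourier[OF G r])
  have f0: "f (x, s) = 0" if "x \<in> A" for x s
    using zero[OF that] by (simp add: f_def inverse_partial_fourier_def G_def)
  have "((\<lambda>(r, s). coef r s * point_mass (r, s) f) has_sum 0) (A \<times> B)"
    by (rule has_sum_0) (auto simp: point_mass_def f0)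
  from has_sum_unique[OF W[OF f] this] have "matrix_wigner T \<mu> \<nu> f = 0" .
  moreover have "partial_fourier f = G"
    unfolding f_def by (rule partial_fourier_inverse_partial_fourier[OF G r])
  then have "(\<lambda>z. partial_fourier f (inv T z)) = F"
    by (simp add: G_def surj_f_inv_f[OF surj])
  ultimately have "tensor_distribution \<mu> (conj_distribution \<nu>) F / complex_of_real \<bar>det2 T\<bar> = 0"
    by (simp add: matrix_wigner_def partial_fourier_distribution_def pullback_def)
  moreover have "det2 T \<noteq> 0" by (rule det2_nonzero[OF T(1) inj])
  ultimately show ?thesis by simp
qed

lemma tensor_distribution_product:
  fixes u v :: "real functional" and \<phi> \<psi> :: "real \<Rightarrow> complex" and a b r :: real
  assumes "test_linear u" "test_linear v" "test_function \<phi>" "test_function \<psi>"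
  shows "tensor_distribution u v (\<lambda>(x, y). complex_of_real (a * x + b * y - r) * (\<phi> x * \<psi> y)) =
    a * u (\<lambda>x. x * \<phi> x) * v \<psi> + b * u \<phi> * v (\<lambda>y. y * \<psi> y) - r * u \<phi> * v \<psi>"
proof -
  have x\<phi>: "test_function (\<lambda>x. x * \<phi> x)" and y\<psi>: "test_function (\<lambda>x. x * \<psi> x)"
    by (intro test_function_mult smooth_coord assms)+
  have "v (\<lambda>y. complex_of_real (a * x + b * y - r) * (\<phi> x * \<psi> y)) =
      (a * v \<psi>) * (x * \<phi> x) + (b * v (\<lambda>y. y * \<psi> y) - r * v \<psi>) * \<phi> x" for x
  proof -
    have "v (\<lambda>y. ((a * x - r) * \<phi> x) * \<psi> y + (b * \<phi> x) * (y * \<psi> y)) =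
        ((a * x - r) * \<phi> x) * v \<psi> + (b * \<phi> x) * v (\<lambda>y. y * \<psi> y)"
      by (simp only: test_linear_add[OF assms(2) test_function_cmult[OF assms(4)] test_function_cmult[OF y\<psi>]]
          test_linear_cmult[OF assms(2,4)] test_linear_cmult[OF assms(2) y\<psi>])
    moreover have "(\<lambda>y. complex_of_real (a * x + b * y - r) * (\<phi> x * \<psi> y)) =
        (\<lambda>y. ((a * x - r) * \<phi> x) * \<psi> y + (b * \<phi> x) * (y * \<psi> y))"
      by (simp add: fun_eq_iff algebra_simps)
    ultimately show ?thesis by (simp add: algebra_simps)
  qed
  then have "tensor_distribution u v (\<lambda>(x, y). complex_of_real (a * x + b * y - r) * (\<phi> x * \<psi> y)) =
      u (\<lambda>x. (a * v \<psi>) * (x * \<phi> x) + (b * v (\<lambda>y. y * \<psi> y) - r * v \<psi>) * \<phi> x)"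
    by (simp add: tensor_distribution_def)
  also have "\<dots> = (a * v \<psi>) * u (\<lambda>x. x * \<phi> x) + (b * v (\<lambda>y. y * \<psi> y) - r * v \<psi>) * u \<phi>"
    by (simp only: test_linear_add[OF assms(1) test_function_cmult[OF x\<phi>] test_function_cmult[OF assms(3)]]
        test_linear_cmult[OF assms(1,3)] test_linear_cmult[OF assms(1) x\<phi>])
  finally show ?thesis by (simp add: algebra_simps)
qed

lemma test_function_line_product:
  fixes \<phi> \<psi> :: "real \<Rightarrow> complex" and a b r :: real
  assumes "test_function \<phi>" "test_function \<psi>"
  shows "test_function (\<lambda>(x, y). complex_of_real (a * x + b * y - r) * (\<phi> x * \<psi> y))"
proof -
  obtain R1 where R1: "\<And>x. norm x \<ge> R1 \<Longrightarrow> \<phi> x = 0" using assms(1) by (auto simp: test_function_iff)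
  obtain R2 where R2: "\<And>x. norm x \<ge> R2 \<Longrightarrow> \<psi> x = 0" using assms(2) by (auto simp: test_function_iff)
  show ?thesis
    unfolding case_prod_unfold
  proof (rule test_functionI[of _ "R1 + R2"])
    have "smooth (\<lambda>z. complex_of_real a * complex_of_real (fst z) + complex_of_real b * complex_of_real (snd z) - complex_of_real r)"
      by (intro smooth_diff smooth_add smooth_mult smooth_const smooth_coord)
    then show "smooth (\<lambda>z. complex_of_real (a * fst z + b * snd z - r) * (\<phi> (fst z) * \<psi> (snd z)))"
      by (intro smooth_mult smooth_compose_real[OF smooth_coord(2) test_function_smooth[OF assms(1)]]
          smooth_compose_real[OF smooth_coord(3) test_function_smooth[OF assms(2)]]) simp
    fix z :: "real \<times> real" assume "norm z \<ge> R1 + R2"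
    then have "norm (fst z) \<ge> R1 \<or> norm (snd z) \<ge> R2"
      using norm_Pair_le[of "fst z" "snd z"] by auto
    then show "complex_of_real (a * fst z + b * snd z - r) * (\<phi> (fst z) * \<psi> (snd z)) = 0"
      using R1 R2 by auto
  qed
qed

theorem theorem16:
  fixes T :: "real \<times> real \<Rightarrow> real \<times> real"
    and a b c d :: real
    and \<mu> \<nu> :: "real functional"
    and A B :: "real set"
    and coef :: "real \<Rightarrow> real \<Rightarrow> complex"
  assumes "linear T" and "bij T"
    and "\<And>x y. inv T (x, y) = (a * x + b * y, c * x + d * y)"
    and "a * b \<noteq> 0"
    and "tempered_distribution \<mu>" and "nonzero_distribution \<mu>"
    and "tempered_distribution \<nu>" and "nonzero_distribution \<nu>"
    and "uniform_discrete A" and "uniform_discrete B"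
    and "\<And>f. schwartz f \<Longrightarrow>
           ((\<lambda>(r, s). coef r s * point_mass (r, s) f) has_sum matrix_wigner T \<mu> \<nu> f) (A \<times> B)"
  shows "given_by_measure \<mu> \<and> (\<exists>S. uniform_discrete S \<and> distribution_support \<mu> \<subseteq> S) \<and>
         given_by_measure \<nu> \<and> (\<exists>S. uniform_discrete S \<and> distribution_support \<nu> \<subseteq> S)"
proof -
  have ab: "a \<noteq> 0" "b \<noteq> 0" using assms(4) by auto
  define v where "v = conj_distribution \<nu>"
  have u: "test_linear \<mu>" by (rule tempered_test_linear[OF assms(5)])
  have v: "test_linear v" unfolding v_def by (rule test_linear_conj[OF tempered_test_linear[OF assms(7)]])
  obtain \<phi>0 where \<phi>0: "test_function \<phi>0" "\<mu> \<phi>0 \<noteq> 0"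
    using nonzero_distribution_test_function[OF assms(5,6)] by blast
  obtain \<psi>0 where \<psi>0: "test_function \<psi>0" "\<nu> \<psi>0 \<noteq> 0"
    using nonzero_distribution_test_function[OF assms(7,8)] by blast
  have v\<psi>0: "v (\<lambda>x. cnj (\<psi>0 x)) \<noteq> 0" using \<psi>0(2) by (simp add: v_def conj_distribution_def)
  obtain \<delta> where \<delta>: "\<delta> > 0" "\<And>r s. r \<in> A \<Longrightarrow> s \<in> A \<Longrightarrow> \<bar>r - s\<bar> < \<delta> \<Longrightarrow> r = s"
    using assms(9) unfolding uniform_discrete_def dist_real_def by blast
  have rel: "a * \<mu> (\<lambda>x. x * \<phi> x) * v \<psi> + b * \<mu> \<phi> * v (\<lambda>y. y * \<psi> y) = r * \<mu> \<phi> * v \<psi>"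
    if \<phi>: "test_function \<phi>" and \<psi>: "test_function \<psi>"
      and line: "\<And>x y. \<phi> x \<noteq> 0 \<Longrightarrow> \<psi> y \<noteq> 0 \<Longrightarrow> a * x + b * y \<in> A \<Longrightarrow> a * x + b * y = r"
    for \<phi> \<psi> :: "real \<Rightarrow> complex" and r :: real
  proof -
    let ?F = "\<lambda>(x, y). complex_of_real (a * x + b * y - r) * (\<phi> x * \<psi> y)"
    have "tensor_distribution \<mu> v ?F = 0"
      unfolding v_def
    proof (rule matrix_wigner_test_function[OF assms(1,2) test_function_line_product[OF \<phi> \<psi>] assms(11)])
      fix x t assume x: "x \<in> A"
      obtain x' y' where T: "T (x, t) = (x', y')" by (cases "T (x, t)")
      then have "inv T (x', y') = (x, t)" using assms(2) by (metis bij_inv_eq_iff)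
      then have "a * x' + b * y' = x" using assms(3) by simp
      then have "a * x' + b * y' - r = 0 \<or> \<phi> x' = 0 \<or> \<psi> y' = 0" using line[of x' y'] x by auto
      then show "?F (T (x, t)) = 0" by (simp only: T prod.case of_real_eq_0_iff mult_eq_0_iff)
    qed
    then show ?thesis using tensor_distribution_product[OF u v \<phi> \<psi>] by simp
  qed
  have "\<exists>\<epsilon>>0. locally_point_mass \<epsilon> \<mu>"
    by (rule locally_point_mass_if_collinear[OF u v ab \<delta> test_function_cnj[OF \<psi>0(1)] v\<psi>0 rel])
  then obtain S w where \<mu>: "discrete_sum S w \<mu>"
    using locally_point_mass_discrete_sum[OF u] by blast
  have "\<exists>\<epsilon>>0. locally_point_mass \<epsilon> v"
  proof (rule locally_point_mass_if_collinear[OF v u ab(2,1) \<delta> \<phi>0])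
    fix \<phi> \<psi> :: "real \<Rightarrow> complex" and r :: real
    assume "test_function \<phi>" "test_function \<psi>"
      and "\<And>x y. \<phi> x \<noteq> 0 \<Longrightarrow> \<psi> y \<noteq> 0 \<Longrightarrow> b * x + a * y \<in> A \<Longrightarrow> b * x + a * y = r"
    then have "a * \<mu> (\<lambda>x. x * \<psi> x) * v \<phi> + b * \<mu> \<psi> * v (\<lambda>y. y * \<phi> y) = r * \<mu> \<psi> * v \<phi>"
      by (intro rel) (auto simp: add.commute)
    then show "b * v (\<lambda>x. x * \<phi> x) * \<mu> \<psi> + a * v \<phi> * \<mu> (\<lambda>y. y * \<psi> y) = r * v \<phi> * \<mu> \<psi>"
      by (simp add: algebra_simps)
  qed
  then obtain S' w' where "discrete_sum S' w' v"
    using locally_point_mass_discrete_sum[OF v] by blast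
  from discrete_sum_conj[OF this] have \<nu>: "discrete_sum S' (\<lambda>x. cnj (w' x)) \<nu>" by (simp add: v_def)
  show ?thesis
    using discrete_sum_given_by_measure[OF \<mu>] discrete_sum_support[OF \<mu>]
      discrete_sum_given_by_measure[OF \<nu>] discrete_sum_support[OF \<nu>] \<mu> \<nu>
    unfolding discrete_sum_def by blast
qed

end
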